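(* Let $L$ be a sign labeling of a finite simple undirected graph $G=(V,\mathcal{E})$. Then the following are equivalent: (1) $L$ is an OM-labeling. (2) For all $v,w\in V$ with $v\neq w$ there are exactly $|L(v)^0\setminus L(w)^0|$ vertex-disjoint crabbed $(v,w)$-paths in $G$; that is, the maximum number of distinct, pairwise internally vertex-disjoint crabbed $(v,w)$-paths is $|L(v)^0\setminus L(w)^0|$. (3) For all $v,w\in V$ with $L(v)^0\neq L(w)^0$ there exists a crabbed $(v,w)$-path in $G$.
   Context: Let $E$ be a finite ground set with $|E|=n$, and let $r$ be an integer with $1\le r\le n$. A sign vector on $E$ is an element $X\in\{+,-,0\}^E$. Write $X^+=\{e\in E: X_e=+\}$, $X^-=\{e\in E: X_e=-\}$, $X^0=\{e\in E: X_e=0\}$ (the zero-support), and $\underline{X}=E\setminus X^0$ (the support). $-X$ is $X$ with all signs reversed. The separator of $X,Y$ is $S(X,Y)=\{e\in E:\{X_e,Y_e\}=\{+,-\}\}$. $\Delta$ denotes symmetric difference. For a set $\mathcal{S}\subseteq\{+,-,0\}^E$ consider the axioms: (C1) Every $X\in\mathcal{S}$ has support of size $n-r+1$. (C2) For every $I\subseteq E$ of size $n-r+1$ there are exactly two elements $X,Y\in\mathcal{S}$ with support $I$; moreover $Y=-X$. (C3) For all $X,Y\in\mathcal{S}$ with $X\neq -Y$ and every $e\in S(X,Y)$ there is $Z\in\mathcal{S}$ with $Z_e=0$ and $Z_f\in\{X_f,Y_f,0\}$ for every $f\in E\setminus\{e\}$. A uniform oriented matroid of rank $r$ is a pair $(E,\mathcal{C}^*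 )$ where $\mathcal{C}^*\subseteq\{+,-,0\}^E$ (the set of cocircuits) satisfies (C1), (C2), (C3). A sign labeling of a graph $G=(V,\mathcal{E})$ (with parameters $r,n$) is a bijection $L:V\to\mathcal{S}$ onto a set $\mathcal{S}$ of sign vectors on $E$ satisfying (C1) and (C2), such that $\{v,w\}\in\mathcal{E}$ if and only if $|L(v)^0\,\Delta\, L(w)^0|=2$ and $S(L(v),L(w))=\emptyset$. A sign labeling is an OM-labeling if $\mathcal{S}$ also satisfies (C3), i.e. $\mathcal{S}$ is the set of cocircuits of a uniform oriented matroid. A $(v,w)$-path $P$ in $G$ is crabbed if every vertex $u\in P$ satisfies $L(u)^+\subseteq L(v)^+\cup L(w)^+$ and $L(u)^-\subseteq L(v)^-\cup L(w)^-$. A set of $(v,w)$-paths is called vertex-disjoint if the paths pairwise share no vertices other than $v$ and $w$. *)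

theory Defs
  imports "Graph_Theory.Graph_Theory"
begin

datatype sign = Pos | Neg | Zero

fun neg_sign :: "sign \<Rightarrow> sign" where
  "neg_sign Pos = Neg"
| "neg_sign Neg = Pos"
| "neg_sign Zero = Zero"

type_synonym 'e sign_vector = "'e \<Rightarrow> sign"

text \<open>
  The elements of the set of all maps from \<open>E\<close> to the signs are represented by the total
  functions that take the value \<open>Zero\<close> outside \<open>E\<close>, so that equality of sign vectors is
  equality of functions and negation stays inside the set.
\<close>

definition sign_vectors :: "'e set \<Rightarrow> 'e sign_vector set" where
  "sign_vectors E = {X. \<forall>e. e \<notin> E \<longrightarrow> X e = Zero}"

definition neg_vector :: "'e sign_vector \<Rightarrow> 'e sign_vector" where
  "neg_vector X = (\<lambda>e. neg_sign (X e))"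

definition pos_part :: "'e set \<Rightarrow> 'e sign_vector \<Rightarrow> 'e set" where
  "pos_part E X = {e \<in> E. X e = Pos}"

definition neg_part :: "'e set \<Rightarrow> 'e sign_vector \<Rightarrow> 'e set" where
  "neg_part E X = {e \<in> E. X e = Neg}"

definition zero_support :: "'e set \<Rightarrow> 'e sign_vector \<Rightarrow> 'e set" where
  "zero_support E X = {e \<in> E. X e = Zero}"

definition support :: "'e set \<Rightarrow> 'e sign_vector \<Rightarrow> 'e set" where
  "support E X = E - zero_support E X"

definition separator :: "'e set \<Rightarrow> 'e sign_vector \<Rightarrow> 'e sign_vector \<Rightarrow> 'e set" where
  "separator E X Y = {e \<in> E. {X e, Y e} = {Pos, Neg}}"

definition axiom_C1 :: "'e set \<Rightarrow> nat \<Rightarrow> 'e sign_vector set \<Rightarrow> bool" where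
  "axiom_C1 E r S \<longleftrightarrow> (\<forall>X\<in>S. card (support E X) = card E - r + 1)"

definition axiom_C2 :: "'e set \<Rightarrow> nat \<Rightarrow> 'e sign_vector set \<Rightarrow> bool" where
  "axiom_C2 E r S \<longleftrightarrow>
    (\<forall>I. I \<subseteq> E \<and> card I = card E - r + 1 \<longrightarrow>
      (\<exists>X Y. X \<noteq> Y \<and> {Z \<in> S. support E Z = I} = {X, Y} \<and> Y = neg_vector X))"

definition axiom_C3 :: "'e set \<Rightarrow> 'e sign_vector set \<Rightarrow> bool" where
  "axiom_C3 E S \<longleftrightarrow>
    (\<forall>X\<in>S. \<forall>Y\<in>S. X \<noteq> neg_vector Y \<longrightarrow>
      (\<forall>e\<in>separator E X Y.
        \<exists>Z\<in>S. Z e = Zero \<and> (\<forall>f\<in>E - {e}. Z f \<in> {X f, Y f, Zero})))"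

definition uniform_oriented_matroid :: "'e set \<Rightarrow> nat \<Rightarrow> 'e sign_vector set \<Rightarrow> bool" where
  "uniform_oriented_matroid E r S \<longleftrightarrow>
    finite E \<and> 1 \<le> r \<and> r \<le> card E \<and> S \<subseteq> sign_vectors E \<and>
    axiom_C1 E r S \<and> axiom_C2 E r S \<and> axiom_C3 E S"

text \<open>
  A finite simple undirected graph is a \<^locale>\<open>pair_graph\<close>, whose set of arcs is symmetric
  and irreflexive; \<open>{v, w}\<close> is an edge iff \<open>(v, w)\<close> is an arc. The set that the bijection
  \<open>L\<close> maps onto is necessarily the image of the vertex set.
\<close>

definition sign_labeling ::
    "'e set \<Rightarrow> nat \<Rightarrow> 'v pair_pre_digraph \<Rightarrow> ('v \<Rightarrow> 'e sign_vector) \<Rightarrow> bool" where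
  "sign_labeling E r G L \<longleftrightarrow>
    inj_on L (pverts G) \<and> L ` pverts G \<subseteq> sign_vectors E \<and>
    axiom_C1 E r (L ` pverts G) \<and> axiom_C2 E r (L ` pverts G) \<and>
    (\<forall>v\<in>pverts G. \<forall>w\<in>pverts G.
      (v, w) \<in> parcs G \<longleftrightarrow>
        card (sym_diff (zero_support E (L v)) (zero_support E (L w))) = 2 \<and>
        separator E (L v) (L w) = {})"

definition OM_labeling ::
    "'e set \<Rightarrow> nat \<Rightarrow> 'v pair_pre_digraph \<Rightarrow> ('v \<Rightarrow> 'e sign_vector) \<Rightarrow> bool" where
  "OM_labeling E r G L \<longleftrightarrow>
    sign_labeling E r G L \<and> uniform_oriented_matroid E r (L ` pverts G)"

definition crabbed :: "'e set \<Rightarrow> ('v \<Rightarrow> 'e sign_vector) \<Rightarrow> 'v \<Rightarrow> 'v \<Rightarrow> 'v list \<Rightarrow> bool" where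
  "crabbed E L v w p \<longleftrightarrow>
    (\<forall>u\<in>set p.
      pos_part E (L u) \<subseteq> pos_part E (L v) \<union> pos_part E (L w) \<and>
      neg_part E (L u) \<subseteq> neg_part E (L v) \<union> neg_part E (L w))"

text \<open>Paths are given by their vertex sequence, read from \<open>v\<close> to \<open>w\<close>.\<close>

definition crabbed_paths ::
    "'e set \<Rightarrow> 'v pair_pre_digraph \<Rightarrow> ('v \<Rightarrow> 'e sign_vector) \<Rightarrow> 'v \<Rightarrow> 'v \<Rightarrow> 'v list set" where
  "crabbed_paths E G L v w =
    {p. vpath p (with_proj G) \<and> hd p = v \<and> last p = w \<and> crabbed E L v w p}"

definition vertex_disjoint :: "'v \<Rightarrow> 'v \<Rightarrow> 'v list set \<Rightarrow> bool" where
  "vertex_disjoint v w P \<longleftrightarrow> (\<forall>p\<in>P. \<forall>q\<in>P. p \<noteq> q \<longrightarrow> set p \<inter> set q \<subseteq> {v, w})"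

definition max_disjoint_crabbed_paths ::
    "'e set \<Rightarrow> 'v pair_pre_digraph \<Rightarrow> ('v \<Rightarrow> 'e sign_vector) \<Rightarrow> 'v \<Rightarrow> 'v \<Rightarrow> nat \<Rightarrow> bool" where
  "max_disjoint_crabbed_paths E G L v w k \<longleftrightarrow>
    (\<exists>P \<subseteq> crabbed_paths E G L v w. vertex_disjoint v w P \<and> finite P \<and> card P = k) \<and>
    (\<forall>P \<subseteq> crabbed_paths E G L v w. vertex_disjoint v w P \<longrightarrow> finite P \<and> card P \<le> k)"

end

theory Submission
  imports Defs
begin

text \<open>
  The signs in two adjacent cocircuits never disagree, so a crabbed path between two cocircuits
  that are separated by \<open>e\<close> passes through a cocircuit vanishing at \<open>e\<close>; this gives elimination.

  Conversely, let \<open>v \<noteq> w\<close> be vertices of an oriented matroid and let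
  \<open>k = card (zero_support E (L v) - zero_support E (L w))\<close>. A crabbed path leaves \<open>v\<close> by making
  some \<open>a\<close> in \<open>zero_support E (L v) - zero_support E (L w)\<close> non-zero, with the sign of \<open>L w\<close>, and
  this determines its second vertex. So there are at most \<open>k\<close> disjoint crabbed paths.

  For the existence of \<open>k\<close> paths it suffices, by Menger's theorem, that no set \<open>F\<close> of fewer than
  \<open>k\<close> further vertices separates \<open>v\<close> from \<open>w\<close> in the cell cut out by the signs on which they
  agree. The facet constraints of the cell are imposed one at a time. When \<open>g \<ge> 0\<close> is added, a
  path that crosses to \<open>g < 0\<close> is rerouted inside the hyperplane \<open>g = 0\<close>, by induction on the
  dimension. This fails only if all of \<open>F\<close> lies on that hyperplane, and then the path is chosen
  in the open half-space \<open>g > 0\<close>, which is connected within the cell.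
\<close>

section \<open>Menger's theorem\<close>

definition walk :: "('a \<times> 'a) set \<Rightarrow> 'a list \<Rightarrow> bool" where
  "walk A p \<longleftrightarrow> p \<noteq> [] \<and> successively (\<lambda>x y. (x, y) \<in> A) p"

text \<open>\<open>D\<close> may meet \<open>P\<close> and \<open>Q\<close>. A single vertex of
  \<open>P \<inter> Q\<close> is already a walk, so it has to lie in \<open>D\<close>.\<close>

definition separates :: "('a \<times> 'a) set \<Rightarrow> 'a set \<Rightarrow> 'a set \<Rightarrow> 'a set \<Rightarrow> bool" where
  "separates A P Q D \<longleftrightarrow>
    (\<forall>p. walk A p \<and> hd p \<in> P \<and> last p \<in> Q \<longrightarrow> set p \<inter> D \<noteq> {})"

text \<open>The family is indexed so that it can later be re-indexed by the ends of its paths. Walks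
  are non-empty, so different indices carry different paths.\<close>

definition disjoint_paths ::
    "('a \<times> 'a) set \<Rightarrow> 'a set \<Rightarrow> 'a set \<Rightarrow> 'a set \<Rightarrow> ('a \<Rightarrow> 'a list) \<Rightarrow> bool" where
  "disjoint_paths A P Q I p \<longleftrightarrow>
    (\<forall>i\<in>I. walk A (p i) \<and> distinct (p i) \<and> hd (p i) \<in> P \<and> last (p i) \<in> Q) \<and>
    (\<forall>i\<in>I. \<forall>j\<in>I. i \<noteq> j \<longrightarrow> set (p i) \<inter> set (p j) = {})"

lemma walk_mono: "walk A p \<Longrightarrow> A \<subseteq> B \<Longrightarrow> walk B p"
  unfolding walk_def by (auto intro: successively_mono)

lemma walk_Cons: "walk A (x # p) \<longleftrightarrow> p = [] \<or> (x, hd p) \<in> A \<and> walk A p"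
  by (cases p) (auto simp: walk_def)

lemma walk_append: "walk A (p @ q) \<longleftrightarrow>
   (if p = [] then walk A q else if q = [] then walk A p
    else walk A p \<and> walk A q \<and> (last p, hd q) \<in> A)"
  by (auto simp: walk_def successively_append_iff)

text \<open>Traversing the arc \<open>(x, y)\<close> requires an occurrence of \<open>x\<close>
  before the last vertex.\<close>

lemma walk_insert_source:
  "walk (insert (x, y) A) p \<Longrightarrow> x \<notin> set (butlast p) \<Longrightarrow> walk A p"
proof (induction p)
  case (Cons a p)
  then show ?case by (auto simp: walk_Cons split: if_splits)
qed (simp add: walk_def)

lemma walk_insert_target:
  "walk (insert (x, y) A) p \<Longrightarrow> y \<notin> set (tl p) \<Longrightarrow> walk A p"
proof (induction p)
  case (Cons a p)
  then show ?case by (cases p) (auto simp: walk_Cons)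
qed (simp add: walk_def)

lemma walk_concat:
  assumes "walk A (p @ [z])" "walk A (z # q)"
  shows "walk A (p @ z # q)"
  using assms by (auto simp: walk_append walk_Cons split: if_splits)

lemma rtrancl_distinct_walk:
  assumes "(x, y) \<in> A\<^sup>*"
  obtains p where "walk A p" "distinct p" "hd p = x" "last p = y"
  using assms
proof (induction arbitrary: thesis rule: rtrancl_induct)
  case base
  show ?case by (rule base[of "[x]"]) (auto simp: walk_def)
next
  case (step y z)
  then obtain p where p: "walk A p" "distinct p" "hd p = x" "last p = y" by blast
  then have ne: "p \<noteq> []" by (simp add: walk_def)
  show ?case
  proof (cases "z \<in> set p")
    case True
    then obtain q s where q: "p = q @ z # s" by (meson split_list)
    have "walk A (q @ [z])" using p(1) unfolding q by (auto simp: walk_append walk_Cons split: if_splits)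
    then show ?thesis using p q by (intro step.prems[of "q @ [z]"]) (auto simp: hd_append)
  next
    case False
    then show ?thesis using p ne step.hyps
      by (intro step.prems[of "p @ [z]"]) (auto simp: walk_append walk_Cons)
  qed
qed

text \<open>Disjoint paths have different last vertices, so by counting each vertex of
  \<open>D\<close> ends exactly one path. A vertex of \<open>D\<close> met by some path also lies on
  the path that it ends, and by disjointness these two paths coincide.\<close>

lemma disjoint_paths_index_last:
  assumes "disjoint_paths A P D I p" "card I = card D" "finite D" "D \<noteq> {}"
  obtains p' where "disjoint_paths A P D D p'" "\<And>d. d \<in> D \<Longrightarrow> last (p' d) = d"
    "\<And>d. d \<in> D \<Longrightarrow> set (p' d) \<inter> D = {d}"
proof -
  have ne: "p i \<noteq> []" if "i \<in> I" for i using assms(1) that by (auto simp: disjoint_paths_def walk_def)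
  have "inj_on (\<lambda>i. last (p i)) I"
  proof (rule inj_onI)
    fix i j assume "i \<in> I" "j \<in> I" "last (p i) = last (p j)"
    then show "i = j" using assms(1) ne last_in_set[of "p i"] last_in_set[of "p j"]
      unfolding disjoint_paths_def by fastforce
  qed
  moreover have "(\<lambda>i. last (p i)) ` I \<subseteq> D" using assms(1) by (auto simp: disjoint_paths_def)
  ultimately have bij: "bij_betw (\<lambda>i. last (p i)) I D"
    using assms(2,3) by (simp add: bij_betw_def card_image card_subset_eq)
  define g where "g = inv_into I (\<lambda>i. last (p i))"
  have g: "g d \<in> I" "last (p (g d)) = d" if "d \<in> D" for d
    using bij_betw_inv_into_right[OF bij that] bij_betw_apply[OF bij_betw_inv_into[OF bij] that]
    by (simp_all add: g_def)
  have g': "g d \<noteq> g d'" if "d \<in> D" "d' \<in> D" "d \<noteq> d'" for d d'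
    using g that by metis
  have dis: "disjoint_paths A P D D (p \<circ> g)"
    using assms(1) g g' unfolding disjoint_paths_def by simp
  show ?thesis
  proof (rule that[OF dis])
    fix d assume d: "d \<in> D"
    show "last ((p \<circ> g) d) = d" using g d by simp
    show "set ((p \<circ> g) d) \<inter> D = {d}"
    proof (intro equalityI subsetI)
      fix c assume c: "c \<in> set ((p \<circ> g) d) \<inter> D"
      then have "c \<in> set ((p \<circ> g) c)" using g[of c] ne[of "g c"] last_in_set[of "p (g c)"] by auto
      then show "c \<in> {d}" using dis c d unfolding disjoint_paths_def by blast
    qed (use d g[of d] ne[of "g d"] last_in_set[of "p (g d)"] in auto)
  qed
qed

text \<open>Reversing all arcs and all paths exchanges first and last vertices.\<close>

lemma disjoint_paths_index_hd:
  assumes "disjoint_paths A D Q I p" "card I = card D" "finite D" "D \<noteq> {}"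
  obtains p' where "disjoint_paths A D Q D p'" "\<And>d. d \<in> D \<Longrightarrow> hd (p' d) = d"
    "\<And>d. d \<in> D \<Longrightarrow> set (p' d) \<inter> D = {d}"
proof -
  have rev_walk: "walk (B\<inverse>) (rev q) \<longleftrightarrow> walk B q" for B and q :: "'a list"
    by (simp add: walk_def successively_rev)
  have rev_dw: "disjoint_paths (B\<inverse>) Q' P' J (rev \<circ> q) \<longleftrightarrow> disjoint_paths B P' Q' J q"
    for B P' Q' J and q :: "'a \<Rightarrow> 'a list"
    unfolding disjoint_paths_def comp_apply rev_walk set_rev
    by (auto simp: walk_def hd_rev last_rev)
  have "disjoint_paths (A\<inverse>) Q D I (rev \<circ> p)" using assms(1) rev_dw by blast
  then obtain p' where p': "disjoint_paths (A\<inverse>) Q D D p'" "\<And>d. d \<in> D \<Longrightarrow> last (p' d) = d"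
    "\<And>d. d \<in> D \<Longrightarrow> set (p' d) \<inter> D = {d}"
    using disjoint_paths_index_last[OF _ assms(2-4)] by metis
  show ?thesis
  proof (rule that[of "rev \<circ> p'"])
    show "disjoint_paths A D Q D (rev \<circ> p')" using p'(1) rev_dw[of "A\<inverse>" D Q D p'] by simp
  qed (use p' in \<open>auto simp: hd_rev\<close>)
qed

text \<open>Induction on the arc set. If deleting \<open>(x, y)\<close> creates a separating set
  \<open>D\<close> with fewer than \<open>k\<close> vertices, then \<open>insert x D\<close> and
  \<open>insert y D\<close> separate with the arc present and have exactly \<open>k\<close>
  vertices. The induction hypothesis gives \<open>k\<close> paths into the first set and
  \<open>k\<close> paths out of the second, and these are glued.\<close>

theorem menger:
  fixes A :: "('a \<times> 'a) set"
  assumes "finite A" "irrefl A" "finite P"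
    and "\<And>D. finite D \<Longrightarrow> separates A P Q D \<Longrightarrow> k \<le> card D"
  obtains I p where "card I = k" "finite I" "disjoint_paths A P Q I p"
  using assms
proof (induction A arbitrary: P Q thesis rule: finite_induct)
  case empty
  \<comment> \<open>Without arcs every walk is a single vertex.\<close>
  have "separates {} P Q (P \<inter> Q)"
    unfolding separates_def walk_def
  proof (intro allI impI; elim conjE)
    fix p :: "'a list" assume "p \<noteq> []" "successively (\<lambda>x y. (x, y) \<in> {}) p" "hd p \<in> P" "last p \<in> Q"
    then show "set p \<inter> (P \<inter> Q) \<noteq> {}"
      by (cases p rule: remdups_adj.cases) auto
  qed
  then have "k \<le> card (P \<inter> Q)" using empty by blast
  then obtain I where "I \<subseteq> P \<inter> Q" "card I = k" "finite I"
    using obtain_subset_with_card_n by blast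
  then show ?case
    by (intro empty.prems(1)[of I "\<lambda>i. [i]"]) (auto simp: disjoint_paths_def walk_def)
next
  case (insert e A)
  obtain x y where e: "e = (x, y)" by force
  have xy: "x \<noteq> y" and irr: "irrefl A" using insert.prems(2) by (auto simp: e irrefl_def)
  have big: "k \<le> card D" if "finite D" "separates (insert (x, y) A) P Q D" for D
    using insert.prems(4) that e by blast
  show ?case
  proof (cases "\<forall>D. finite D \<longrightarrow> separates A P Q D \<longrightarrow> k \<le> card D")
    case True
    then obtain I p where "card I = k" "finite I" "disjoint_paths A P Q I p"
      using insert.IH[of P Q] irr insert.prems(3) by blast
    then show ?thesis
      by (intro insert.prems(1)[of I p]) (auto simp: disjoint_paths_def intro: walk_mono)
  next
    case False
    then obtain D where D: "finite D" "separates A P Q D" "card D < k" by auto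
    \<comment> \<open>A walk that avoids \<open>x\<close>, or one that avoids \<open>y\<close>,
      cannot use the new arc and is already met by \<open>D\<close>.\<close>
    have sx: "separates (insert (x, y) A) P Q (insert x D)"
      unfolding separates_def
    proof (intro allI impI; elim conjE)
      fix p assume p: "walk (insert (x, y) A) p" "hd p \<in> P" "last p \<in> Q"
      show "set p \<inter> insert x D \<noteq> {}"
      proof (cases "x \<in> set p")
        case False
        then have "walk A p" using p walk_insert_source by (metis in_set_butlastD)
        then show ?thesis using D(2) p unfolding separates_def by blast
      qed auto
    qed
    have sy: "separates (insert (x, y) A) P Q (insert y D)"
      unfolding separates_def
    proof (intro allI impI; elim conjE)
      fix p assume p: "walk (insert (x, y) A) p" "hd p \<in> P" "last p \<in> Q"
      show "set p \<inter> insert y D \<noteq> {}"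
      proof (cases "y \<in> set p")
        case False
        then have "y \<notin> set (tl p)" by (cases p) auto
        then have "walk A p" using p walk_insert_target by metis
        then show ?thesis using D(2) p unfolding separates_def by blast
      qed auto
    qed
    have kx: "k \<le> card (insert x D)" and ky: "k \<le> card (insert y D)"
      using big sx sy D(1) by auto
    then have xD: "x \<notin> D" and yD: "y \<notin> D" using D(1,3) by (auto simp: card_insert_if split: if_splits)
    have cx: "card (insert x D) = k" and cy: "card (insert y D) = k"
      using kx ky D(1,3) xD yD by auto
    \<comment> \<open>Such a \<open>B\<close> also separates \<open>P\<close> from \<open>Q\<close>
      with the arc present: the part of a walk up to its first vertex in \<open>insert x D\<close>
      does not leave \<open>x\<close>, so it is a walk in \<open>A\<close>.\<close>
    have "k \<le> card B" if B: "finite B" "separates A P (insert x D) B" for B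
    proof (rule big[OF B(1)], unfold separates_def, intro allI impI, elim conjE)
      fix p assume p: "walk (insert (x, y) A) p" "hd p \<in> P" "last p \<in> Q"
      then have "\<exists>d\<in>set p. d \<in> insert x D" using sx unfolding separates_def by blast
      then obtain q d s where qds: "p = q @ d # s" "d \<in> insert x D" "\<forall>c\<in>set q. c \<notin> insert x D"
        by (rule split_list_first_propE) blast
      have "walk (insert (x, y) A) (q @ [d])"
        using p(1) unfolding qds(1) by (auto simp: walk_append walk_Cons split: if_splits)
      then have "walk A (q @ [d])" by (rule walk_insert_source) (use qds(3) in auto)
      moreover have "hd (q @ [d]) \<in> P" using p(2) qds(1) by (cases q) auto
      ultimately have "set (q @ [d]) \<inter> B \<noteq> {}"
        using B(2) qds(2) unfolding separates_def by (metis last_snoc)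
      then show "set p \<inter> B \<noteq> {}" using qds(1) by auto
    qed
    then obtain I1 p1 where "card I1 = k" "finite I1" "disjoint_paths A P (insert x D) I1 p1"
      using insert.IH[of P "insert x D"] irr insert.prems(3) by blast
    then obtain f where f: "disjoint_paths A P (insert x D) (insert x D) f"
      "\<And>d. d \<in> insert x D \<Longrightarrow> last (f d) = d"
      "\<And>d. d \<in> insert x D \<Longrightarrow> set (f d) \<inter> insert x D = {d}"
      using disjoint_paths_index_last cx D(1) by (metis finite.insertI insert_not_empty)
    \<comment> \<open>Dually, the part of a walk from its last vertex in \<open>insert y D\<close>
      onwards never enters \<open>y\<close>.\<close>
    have "k \<le> card B" if B: "finite B" "separates A (insert y D) Q B" for B
    proof (rule big[OF B(1)], unfold separates_def, intro allI impI, elim conjE)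
      fix p assume p: "walk (insert (x, y) A) p" "hd p \<in> P" "last p \<in> Q"
      then have "\<exists>d\<in>set p. d \<in> insert y D" using sy unfolding separates_def by blast
      then obtain q d s where qds: "p = q @ d # s" "d \<in> insert y D" "\<forall>c\<in>set s. c \<notin> insert y D"
        by (rule split_list_last_propE) blast
      have "walk (insert (x, y) A) (d # s)"
        using p(1) unfolding qds(1) by (auto simp: walk_append walk_Cons split: if_splits)
      then have "walk A (d # s)" by (rule walk_insert_target) (use qds(3) in auto)
      moreover have "last (d # s) \<in> Q" using p(3) qds(1) by auto
      ultimately have "set (d # s) \<inter> B \<noteq> {}"
        using B(2) qds(2) unfolding separates_def by (metis list.sel(1))
      then show "set p \<inter> B \<noteq> {}" using qds(1) by auto
    qed
    then obtain I2 p2 where "card I2 = k" "finite I2" "disjoint_paths A (insert y D) Q I2 p2"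
      using insert.IH[of "insert y D" Q] irr D(1) by blast
    then obtain g where g: "disjoint_paths A (insert y D) Q (insert y D) g"
      "\<And>d. d \<in> insert y D \<Longrightarrow> hd (g d) = d"
      "\<And>d. d \<in> insert y D \<Longrightarrow> set (g d) \<inter> insert y D = {d}"
      using disjoint_paths_index_hd cy D(1) by (metis finite.insertI insert_not_empty)
    \<comment> \<open>Otherwise the initial segment of \<open>f d\<close> followed by the final segment of \<open>g d'\<close> would avoid \<open>D\<close>.\<close>
    have meet: "z = d \<and> z = d'"
      if d: "d \<in> insert x D" "d' \<in> insert y D" "z \<in> set (f d)" "z \<in> set (g d')" for d d' z
    proof -
      obtain q s where q: "f d = q @ z # s" using d(3) by (meson split_list)
      obtain t u where t: "g d' = t @ z # u" using d(4) by (meson split_list)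
      have wf: "walk A (f d)" "hd (f d) \<in> P" "distinct (f d)"
        and wg: "walk A (g d')" "last (g d') \<in> Q" "distinct (g d')"
        using f(1) g(1) d(1,2) unfolding disjoint_paths_def by auto
      have "walk A (q @ [z])" "walk A (z # u)"
        using wf(1) wg(1) unfolding q t by (auto simp: walk_append walk_Cons split: if_splits)
      then have "walk A (q @ z # u)" by (rule walk_concat)
      moreover have "hd (q @ z # u) \<in> P" "last (q @ z # u) \<in> Q"
        using wf(2) wg(2) unfolding q t by (cases q; auto)+
      ultimately obtain c where c: "c \<in> D" "c \<in> set q \<or> c = z \<or> c \<in> set u"
        using D(2) unfolding separates_def by fastforce
      have last_d: "last (z # s) = d" using f(2)[OF d(1)] q by simp
      have hd_d': "hd (t @ [z]) = d'" using g(2)[OF d(2)] t by (cases t) auto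
      have "d \<notin> set q" using last_d wf(3) q last_in_set[of "z # s"] by auto
      moreover have "c = d" if "c \<in> set q" using f(3)[OF d(1)] c(1) that q by auto
      moreover have "d' \<notin> set u" using hd_d' wg(3) t hd_in_set[of "t @ [z]"] by auto
      moreover have "c = d'" if "c \<in> set u" using g(3)[OF d(2)] c(1) that t by auto
      ultimately have "c = z" using c(2) by blast
      then show ?thesis using c(1) d f(3)[OF d(1)] g(3)[OF d(2)] by blast
    qed
    have wf: "walk A (f d)" "hd (f d) \<in> P" "distinct (f d)" "f d \<noteq> []" if "d \<in> insert x D" for d
      using f(1) that unfolding disjoint_paths_def walk_def by auto
    have wg: "walk A (g d)" "last (g d) \<in> Q" "distinct (g d)" "g d \<noteq> []" if "d \<in> insert y D" for d
      using g(1) that unfolding disjoint_paths_def walk_def by auto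
    \<comment> \<open>The paths \<open>f i\<close> and \<open>g i\<close> are glued at their common
      vertex \<open>i\<close> in \<open>D\<close>; the two remaining paths \<open>f x\<close> and
      \<open>g y\<close> are joined by the arc \<open>(x, y)\<close>. Thus \<open>t i\<close> is the
      first vertex of the second piece.\<close>
    define t where "t i = (if i = x then y else i)" for i
    define h where "h i = f i @ (if i = x then g y else tl (g i))" for i
    have set_h: "set (h i) \<subseteq> set (f i) \<union> set (g (t i))" and t: "t i \<in> insert y D"
      if "i \<in> insert x D" for i
      using that wg(4)[of i] unfolding h_def t_def by (auto dest: list.set_sel(2))
    have "walk (insert (x, y) A) (h i) \<and> distinct (h i) \<and> hd (h i) \<in> P \<and> last (h i) \<in> Q"
      if i: "i \<in> insert x D" for i
    proof (cases "i = x")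
      case True
      have w: "walk (insert (x, y) A) (f x)" "walk (insert (x, y) A) (g y)"
        using wf(1) wg(1) by (auto intro: walk_mono)
      have "set (f x) \<inter> set (g y) = {}" using meet[of x y] xy by blast
      then show ?thesis
        using w wf[of x] wg[of y] f(2)[of x] g(2)[of y] True by (auto simp: h_def walk_append)
    next
      case False
      then have i: "i \<in> D" using i by simp
      have fi: "f i = butlast (f i) @ [i]" using wf(4)[of i] f(2)[of i] i
        by (metis append_butlast_last_id insertI2)
      have gi: "g i = i # tl (g i)" using wg(4)[of i] g(2)[of i] i
        by (metis insertI2 list.collapse)
      have hi: "h i = butlast (f i) @ i # tl (g i)"
        using False fi unfolding h_def by (metis append.assoc append_Cons append_Nil)
      have "walk A (butlast (f i) @ [i])" "walk A (i # tl (g i))"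
        using wf(1)[of i] wg(1)[of i] fi gi i by auto
      then have "walk A (h i)" unfolding hi by (rule walk_concat)
      then have "walk (insert (x, y) A) (h i)" by (rule walk_mono) auto
      moreover have "set (f i) \<inter> set (tl (g i)) = {}"
      proof -
        have "i \<notin> set (tl (g i))" using wg(3)[of i] gi i by (metis distinct.simps(2) insertI2)
        moreover have "z = i" if "z \<in> set (f i)" "z \<in> set (tl (g i))" for z
          using meet[of i i z] i that list.set_sel(2)[OF wg(4)[of i]] by blast
        ultimately show ?thesis by blast
      qed
      then have "distinct (h i)"
        using False wf(3)[of i] wg(3)[of i] i by (simp add: h_def distinct_tl)
      moreover have "hd (h i) \<in> P" using wf(2,4)[of i] i by (simp add: h_def)
      moreover have "last (h i) \<in> Q"
        using wg(2)[of i] i gi unfolding hi by (metis insertI2 last_appendR list.discI)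
      ultimately show ?thesis by blast
    qed
    moreover have "set (h i) \<inter> set (h j) = {}"
      if ij: "i \<in> insert x D" "j \<in> insert x D" "i \<noteq> j" for i j
    proof -
      have "t i \<noteq> t j" using ij yD unfolding t_def by auto
      then have "set (f i) \<inter> set (f j) = {}" "set (g (t i)) \<inter> set (g (t j)) = {}"
        using f(1) g(1) ij(1,2,3) t[OF ij(1)] t[OF ij(2)] unfolding disjoint_paths_def by blast+
      \<comment> \<open>By \<open>meet\<close>, a common vertex would force
        \<open>i' = t j'\<close>, which happens only if \<open>i' = j'\<close> lies in
        \<open>D\<close>.\<close>
      moreover have "set (f i') \<inter> set (g (t j')) = {}"
        if "i' \<in> insert x D" "j' \<in> insert x D" "i' \<noteq> j'" for i' j'
      proof -
        have "i' \<noteq> t j'" using that xy yD unfolding t_def by auto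
        then show ?thesis using meet[of i' "t j'"] that t by blast
      qed
      note this[OF ij(1,2)] this[OF ij(2,1)]
      ultimately show ?thesis using set_h[OF ij(1)] set_h[OF ij(2)] ij(3) by blast
    qed
    ultimately have "disjoint_paths (insert (x, y) A) P Q (insert x D) h"
      unfolding disjoint_paths_def by blast
    then show ?thesis using insert.prems(1) cx D(1) e by blast
  qed
qed

section \<open>Cocircuit graphs of uniform oriented matroids\<close>

lemma separator_iff:
  "e \<in> separator E X Y \<longleftrightarrow> e \<in> E \<and> X e \<noteq> Zero \<and> Y e \<noteq> Zero \<and> X e \<noteq> Y e"
  by (cases "X e"; cases "Y e") (auto simp: separator_def doubleton_eq_iff)

lemma separator_commute: "separator E X Y = separator E Y X"
  by (auto simp: separator_iff)

lemma in_zero_support: "e \<in> zero_support E X \<longleftrightarrow> e \<in> E \<and> X e = Zero"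
  by (simp add: zero_support_def)

lemma neg_sign_eq_Zero [simp]: "neg_sign s = Zero \<longleftrightarrow> s = Zero"
  by (cases s) auto

lemma neg_sign_eq_iff: "s \<noteq> Zero \<Longrightarrow> t \<noteq> Zero \<Longrightarrow> neg_sign s = t \<longleftrightarrow> s \<noteq> t"
  by (cases s; cases t) auto

lemma neg_neg_vector [simp]: "neg_vector (neg_vector X) = X"
proof
  show "neg_vector (neg_vector X) e = X e" for e by (cases "X e") (auto simp: neg_vector_def)
qed

lemma zero_support_neg [simp]: "zero_support E (neg_vector X) = zero_support E X"
  by (simp add: zero_support_def neg_vector_def)

section \<open>Zero supports of cocircuits and elimination\<close>

locale uniform_om =
  fixes E :: "'e set" and r :: nat and S :: "'e sign_vector set"
  assumes uom: "uniform_oriented_matroid E r S"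
begin

abbreviation zs :: "'e sign_vector \<Rightarrow> 'e set" where "zs \<equiv> zero_support E"

lemma fin: "finite E" and r_le: "1 \<le> r" "r \<le> card E"
  using uom by (auto simp: uniform_oriented_matroid_def)

lemma zs_subset: "zs X \<subseteq> E" and finite_zs: "finite (zs X)"
  using fin by (auto simp: zero_support_def)

lemma finite_separator: "finite (separator E X Y)"
  using fin by (simp add: separator_def)

lemma zero_outside: "X \<in> S \<Longrightarrow> e \<notin> E \<Longrightarrow> X e = Zero"
  using uom by (auto simp: uniform_oriented_matroid_def sign_vectors_def)

lemma card_zs: assumes "X \<in> S" shows "card (zs X) = r - 1"
proof -
  have "card (E - zs X) = card E - r + 1"
    using uom assms by (auto simp: uniform_oriented_matroid_def axiom_C1_def support_def)
  moreover have "card (E - zs X) = card E - card (zs X)" "card (zs X) \<le> card E"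
    using zs_subset fin by (auto simp: card_Diff_subset finite_zs card_mono)
  ultimately show ?thesis using r_le by linarith
qed

text \<open>Axiom C2 read through complements: the zero supports have
  \<open>card E - (card E - r + 1) = r - 1\<close> elements.\<close>

lemma two_cocircuits:
  assumes "I \<subseteq> E" "card I = r - 1"
  obtains X where "{Z \<in> S. zs Z = I} = {X, neg_vector X}"
proof -
  have "card (E - I) = card E - r + 1"
    using assms fin r_le by (simp add: card_Diff_subset finite_subset)
  then obtain X where X: "{Z \<in> S. support E Z = E - I} = {X, neg_vector X}"
    using uom unfolding uniform_oriented_matroid_def axiom_C2_def by (metis Diff_subset)
  have "support E Z = E - I \<longleftrightarrow> zs Z = I" for Z
    using assms(1) zs_subset[of Z] unfolding support_def by blast
  then show ?thesis using that X by simp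
qed

lemma same_zs:
  assumes "X \<in> S" "Y \<in> S" "zs X = zs Y"
  shows "Y = X \<or> Y = neg_vector X"
proof -
  obtain U where "{Z \<in> S. zs Z = zs X} = {U, neg_vector U}"
    using two_cocircuits[OF zs_subset card_zs[OF assms(1)]] .
  then have "X \<in> {U, neg_vector U}" "Y \<in> {U, neg_vector U}" using assms by blast+
  then show ?thesis by auto
qed

lemma neg_closed:
  assumes "X \<in> S" shows "neg_vector X \<in> S"
proof -
  obtain U where "{Z \<in> S. zs Z = zs X} = {U, neg_vector U}"
    using two_cocircuits[OF zs_subset card_zs[OF assms]] .
  then have "X \<in> {U, neg_vector U}" "{U, neg_vector U} \<subseteq> S" using assms by blast+
  then show ?thesis by auto
qed

text \<open>Of the two opposite cocircuits with zero support \<open>I\<close>, one has the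
  prescribed sign at \<open>e\<close>.\<close>

lemma cocircuit_with_sign:
  assumes "I \<subseteq> E" "card I = r - 1" "e \<in> E - I" "s \<noteq> Zero"
  obtains X where "X \<in> S" "zs X = I" "X e = s"
proof -
  obtain X where X: "{Z \<in> S. zs Z = I} = {X, neg_vector X}"
    using two_cocircuits assms by metis
  then have "X \<in> S" "zs X = I" "neg_vector X \<in> S" "zs (neg_vector X) = I" by blast+
  moreover have "X e = s \<or> neg_vector X e = s"
    using \<open>zs X = I\<close> assms(3,4) neg_sign_eq_iff[of "X e" s] by (auto simp: in_zero_support neg_vector_def)
  ultimately show ?thesis using that by blast
qed

text \<open>The sign condition of C3 extends to every \<open>f\<close>, because \<open>Z\<close>
  vanishes at \<open>e\<close> and, by the encoding, outside \<open>E\<close>.\<close>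

lemma eliminate:
  assumes "X \<in> S" "Y \<in> S" "X \<noteq> neg_vector Y" "e \<in> separator E X Y"
  obtains Z where "Z \<in> S" "Z e = Zero" "\<And>f. Z f \<in> {X f, Y f, Zero}"
proof -
  obtain Z where Z: "Z \<in> S" "Z e = Zero" "\<forall>f\<in>E - {e}. Z f \<in> {X f, Y f, Zero}"
    using uom assms unfolding uniform_oriented_matroid_def axiom_C3_def by blast
  then have "Z f \<in> {X f, Y f, Zero}" for f
    using zero_outside by (cases "f \<in> E"; cases "f = e") auto
  then show ?thesis using that Z by blast
qed

lemma zs_eqI: "X \<in> S \<Longrightarrow> I \<subseteq> zs X \<Longrightarrow> card I = r - 1 \<Longrightarrow> zs X = I"
  by (metis card_subset_eq card_zs finite_zs)

lemma card_Diff_zs: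
  assumes "X \<in> S" "Y \<in> S"
  shows "card (zs X - zs Y) = r - 1 - card (zs X \<inter> zs Y)" "card (zs X \<inter> zs Y) \<le> r - 1"
  using card_zs[OF assms(1)] card_mono[of "zs X" "zs X \<inter> zs Y"] finite_zs
  by (auto simp: card_Diff_subset_Int)

lemma card_Diff_zs_commute:
  "X \<in> S \<Longrightarrow> Y \<in> S \<Longrightarrow> card (zs X - zs Y) = card (zs Y - zs X)"
  by (simp add: card_Diff_zs Int_commute)

lemma card_zs_exchange:
  assumes "X \<in> S" "a \<in> zs X" "b \<notin> zs X"
  shows "card (insert b (zs X - {a})) = r - 1"
  using assms card_zs[OF assms(1)] finite_zs[of X] card_Suc_Diff1[of "zs X" a] by simp

section \<open>The cocircuit graph and paths inside a set of cocircuits\<close>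

definition edges :: "('e sign_vector \<times> 'e sign_vector) set" where
  "edges = {(X, Y). X \<in> S \<and> Y \<in> S \<and> card (sym_diff (zs X) (zs Y)) = 2 \<and> separator E X Y = {}}"

text \<open>All zero supports have the same size, so the symmetric difference splits into two
  equally large halves.\<close>

lemma edges_iff:
  "(X, Y) \<in> edges \<longleftrightarrow> X \<in> S \<and> Y \<in> S \<and> card (zs X - zs Y) = 1 \<and> separator E X Y = {}"
proof (cases "X \<in> S \<and> Y \<in> S")
  case True
  have "card (sym_diff (zs X) (zs Y)) = card (zs X - zs Y) + card (zs Y - zs X)"
    by (intro card_Un_disjoint) (auto simp: finite_zs)
  then show ?thesis using True card_Diff_zs_commute[of X Y] by (auto simp: edges_def)
qed (auto simp: edges_def)

lemma edges_sym: "(X, Y) \<in> edges \<Longrightarrow> (Y, X) \<in> edges"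
  by (auto simp: edges_iff card_Diff_zs_commute separator_commute)

text \<open>Both ends of every edge must lie in \<open>R\<close>, but the empty path links any
  cocircuit to itself, even one outside \<open>R\<close>.\<close>

definition link :: "'e sign_vector set \<Rightarrow> 'e sign_vector \<Rightarrow> 'e sign_vector \<Rightarrow> bool" where
  "link R X Y \<longleftrightarrow> (X, Y) \<in> (edges \<inter> R \<times> R)\<^sup>*"

lemma link_refl [simp]: "link R X X"
  by (simp add: link_def)

lemma link_trans [trans]: "link R X Y \<Longrightarrow> link R Y Z \<Longrightarrow> link R X Z"
  by (simp add: link_def)

lemma link_sym: "link R X Y \<Longrightarrow> link R Y X"
  unfolding link_def by (rule symD[OF sym_rtrancl]) (auto intro!: symI edges_sym)

lemma link_mono: "link R X Y \<Longrightarrow> R \<subseteq> R' \<Longrightarrow> link R' X Y"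
  unfolding link_def by (rule rtrancl_mono[THEN subsetD]) auto

lemma link_edge: "(X, Y) \<in> edges \<Longrightarrow> X \<in> R \<Longrightarrow> Y \<in> R \<Longrightarrow> link R X Y"
  by (auto simp: link_def)

section \<open>Arcs on a line and neighbours of a cocircuit\<close>

definition between :: "'e sign_vector \<Rightarrow> 'e sign_vector \<Rightarrow> 'e sign_vector set" where
  "between X Y = {U \<in> S. \<forall>f. U f \<in> {X f, Y f, Zero} \<and> (X f = Y f \<longrightarrow> U f = X f)}"

text \<open>Two cocircuits that share all but one zero span a line, and \<open>between X Y\<close>
  is the arc from one to the other. Eliminating an element \<open>s\<close> of the separator gives a
  point \<open>Z\<close> of this arc, and the two partial arcs have strictly smaller
  separators.\<close>

lemma link_between:
  assumes "X \<in> S" "Y \<in> S" "card (zs X - zs Y) = 1"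
  shows "link (between X Y) X Y"
  using assms
proof (induction "card (separator E X Y)" arbitrary: X Y rule: less_induct)
  case less
  note X = less.prems(1) and Y = less.prems(2)
  show ?case
  proof (cases "separator E X Y = {}")
    case True
    then show ?thesis using less.prems
      by (intro link_edge) (auto simp: edges_iff between_def)
  next
    case False
    then obtain s where s: "s \<in> separator E X Y" by blast
    have "X \<noteq> neg_vector Y" using less.prems(3) by auto
    then obtain Z where Z: "Z \<in> S" "Z s = Zero" "\<And>f. Z f \<in> {X f, Y f, Zero}"
      using eliminate X Y s by metis
    have sE: "s \<in> E" "X s \<noteq> Zero" "Y s \<noteq> Zero" "X s \<noteq> Y s" using s by (auto simp: separator_iff)
    have "insert s (zs X \<inter> zs Y) \<subseteq> zs Z" using Z(2) Z(3) sE by (force simp: in_zero_support)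
    moreover have "card (insert s (zs X \<inter> zs Y)) = r - 1"
      using card_Diff_zs[OF X Y] less.prems(3) sE finite_zs by (simp add: in_zero_support)
    ultimately have zZ: "zs Z = insert s (zs X \<inter> zs Y)" using zs_eqI Z(1) by blast
    \<comment> \<open>The only zero of \<open>Z\<close> outside the common zeros is
      \<open>s\<close>, where \<open>X\<close> and \<open>Y\<close> differ, so a common non-zero
      sign survives.\<close>
    have eq: "Z f = X f" if "X f = Y f" for f
      using Z(3)[of f] that zZ sE zero_outside[OF X, of f] zero_outside[OF Z(1), of f]
      by (cases "f \<in> E") (auto simp: in_zero_support set_eq_iff)
    have "zs X - zs Z = zs X - zs Y" "zs Z - zs Y = {s}"
      using sE by (auto simp: zZ in_zero_support)
    then have c: "card (zs X - zs Z) = 1" "card (zs Z - zs Y) = 1" using less.prems(3) by auto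
    have sub: "separator E X Z \<subset> separator E X Y" "separator E Z Y \<subset> separator E X Y"
    proof -
      have "separator E X Z \<subseteq> separator E X Y" "separator E Z Y \<subseteq> separator E X Y"
        using Z(3) by (auto simp: separator_iff; metis insertE emptyE)+
      moreover have "s \<notin> separator E X Z" "s \<notin> separator E Z Y" using Z(2) by (auto simp: separator_iff)
      ultimately show "separator E X Z \<subset> separator E X Y" "separator E Z Y \<subset> separator E X Y"
        using s by auto
    qed
    have "link (between X Z) X Z" "link (between Z Y) Z Y"
      using less.hyps c X Y Z(1) psubset_card_mono[OF finite_separator sub(1)] psubset_card_mono[OF finite_separator sub(2)]
      by blast+
    moreover have "between X Z \<subseteq> between X Y" "between Z Y \<subseteq> between X Y"
      proof -
      show "between X Z \<subseteq> between X Y"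
        using Z(3) eq unfolding between_def by (smt (verit) insert_iff mem_Collect_eq subsetI)
      show "between Z Y \<subseteq> between X Y"
        using Z(3) eq unfolding between_def by (smt (verit) insert_iff mem_Collect_eq subsetI)
    qed
    ultimately show ?thesis by (meson link_mono link_trans)
  qed
qed

text \<open>Start with any cocircuit that keeps the zeros of \<open>X\<close> other than
  \<open>g\<close> and has sign \<open>s\<close> at \<open>g\<close>. As long as it is separated
  from \<open>X\<close>, elimination replaces it by one closer to \<open>X\<close> with the same two
  properties.\<close>

lemma neighbour_with_sign:
  assumes X: "X \<in> S" "g \<in> zs X" and s: "s \<noteq> Zero"
  obtains U where "(X, U) \<in> edges" "U g = s"
proof -
  have *: "\<exists>U. (X, U) \<in> edges \<and> U g = s" if "U \<in> S" "zs X - {g} \<subseteq> zs U" "U g = s" for U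
    using that
  proof (induction "card (separator E X U)" arbitrary: U rule: less_induct)
    case less
    have d: "zs X - zs U = {g}" using less.prems X s by (auto simp: in_zero_support)
    show ?case
    proof (cases "separator E X U = {}")
      case True
      then show ?thesis using less.prems X d by (auto simp: edges_iff)
    next
      case False
      then obtain t where t: "t \<in> separator E X U" by blast
      have "X \<noteq> neg_vector U" using d by auto
      then obtain Z where Z: "Z \<in> S" "Z t = Zero" "\<And>f. Z f \<in> {X f, U f, Zero}"
        using eliminate X less.prems(1) t by metis
      have tE: "t \<in> E" "X t \<noteq> Zero" using t by (auto simp: separator_iff)
      have sub: "zs X - {g} \<subseteq> zs Z" using Z(3) less.prems(2) by (force simp: in_zero_support)
      \<comment> \<open>These \<open>r - 1\<close> zeros exhaust the zero support, so
        \<open>Z g\<close> is non-zero. Since \<open>X g = Zero\<close>, it must be the sign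
        \<open>s\<close> of \<open>U\<close>.\<close>
      have "zs Z = insert t (zs X - {g})"
        using zs_eqI[OF Z(1)] card_zs_exchange[OF X, of t] sub Z(2) tE
        by (simp add: in_zero_support)
      then have "Z g \<noteq> Zero" using tE X(2) by (auto simp: in_zero_support set_eq_iff)
      then have Zg: "Z g = s" using Z(3)[of g] X(2) less.prems(3) by (auto simp: in_zero_support)
      have "separator E X Z \<subset> separator E X U"
      proof
        show "separator E X Z \<subseteq> separator E X U"
          using Z(3) by (auto simp: separator_iff; metis insertE emptyE)
        show "separator E X Z \<noteq> separator E X U" using t Z(2) by (auto simp: separator_iff)
      qed
      then show ?thesis using less.hyps[OF psubset_card_mono[OF finite_separator] Z(1) sub Zg] by blast
    qed
  qed
  \<comment> \<open>Since \<open>r - 1 < card E\<close>, some \<open>b\<close> outside the zero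
    support is available to replace \<open>g\<close>.\<close>
  have "card (zs X) < card E" using card_zs X r_le by simp
  then have "\<not> E \<subseteq> zs X" using card_mono[OF finite_zs[of X], of E] by linarith
  then obtain b where b: "b \<in> E" "b \<notin> zs X" by blast
  obtain U where "U \<in> S" "zs U = insert b (zs X - {g})" "U g = s"
    by (rule cocircuit_with_sign[of "insert b (zs X - {g})" g s])
      (use X s b zs_subset card_zs_exchange[OF X b(2)] in auto)
  then show ?thesis using *[of U] that by blast
qed

text \<open>Eliminating \<open>a\<close> between \<open>U\<close> and \<open>- U'\<close> would yield a cocircuit with the zeros of \<open>X\<close> that is
  neither \<open>X\<close> nor \<open>- X\<close>.\<close>

lemma neighbour_unique:
  assumes e: "(X, U) \<in> edges" "(X, U') \<in> edges" and a: "X a = Zero" "U a = U' a" "U a \<noteq> Zero"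
  shows "U = U'"
proof (rule ccontr)
  assume ne: "U \<noteq> U'"
  have S: "X \<in> S" "U \<in> S" "U' \<in> S" using e by (auto simp: edges_iff)
  have aE: "a \<in> E" using a S zero_outside by blast
  have one: "zs X - zs V = {a}" "\<exists>b. zs V - zs X = {b}" "separator E X V = {}"
    if "(X, V) \<in> edges" "V a \<noteq> Zero" for V
  proof -
    have c: "card (zs X - zs V) = 1" using that by (simp add: edges_iff)
    then obtain c where "zs X - zs V = {c}" by (auto simp: card_1_singleton_iff)
    moreover have "a \<in> zs X - zs V" using that(2) a(1) aE by (simp add: in_zero_support)
    ultimately show "zs X - zs V = {a}" by simp
    have "card (zs V - zs X) = 1" using c that(1) card_Diff_zs_commute[of X V] by (simp add: edges_iff)
    then show "\<exists>b. zs V - zs X = {b}" by (simp add: card_1_singleton_iff)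
    show "separator E X V = {}" using that by (simp add: edges_iff)
  qed
  have a': "U' a \<noteq> Zero" using a by simp
  note U = one[OF e(1) a(3)] and U' = one[OF e(2) a']
  have "a \<in> separator E U (neg_vector U')"
    using a aE neg_sign_eq_iff[of "U' a" "U a"] by (auto simp: separator_iff neg_vector_def)
  moreover have "U \<noteq> neg_vector (neg_vector U')" using ne by simp
  ultimately obtain Z where Z: "Z \<in> S" "Z a = Zero" "\<And>f. Z f \<in> {U f, neg_vector U' f, Zero}"
    using eliminate S(2) neg_closed[OF S(3)] by metis
  have "e \<in> zs Z" if "e \<in> zs X" for e
  proof (cases "e = a")
    case False
    then have "e \<in> zs U" "e \<in> zs U'" using that U(1) U'(1) by blast+
    then show ?thesis using Z(3)[of e] by (auto simp: in_zero_support neg_vector_def)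
  qed (use Z(2) aE in \<open>simp add: in_zero_support\<close>)
  then have zZ: "zs Z = zs X" using zs_eqI[OF Z(1)] card_zs[OF S(1)] by blast
  \<comment> \<open>\<open>b\<close> and \<open>b'\<close> are the zeros gained by \<open>U\<close>
    and \<open>U'\<close>. It turns out that \<open>Z\<close> is opposite to \<open>X\<close> at
    \<open>b\<close> and agrees with \<open>X\<close> at \<open>b'\<close>.\<close>
  obtain b b' where b: "zs U - zs X = {b}" "zs U' - zs X = {b'}" using U(2) U'(2) by auto
  then have "b \<in> zs U - zs X" "b' \<in> zs U' - zs X" by blast+
  then have bz: "b \<in> E" "X b \<noteq> Zero" "U b = Zero" "b' \<in> E" "X b' \<noteq> Zero" "U' b' = Zero"
    and "b \<notin> zs Z" "b' \<notin> zs Z"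
    using zZ by (auto simp: in_zero_support)
  then have "Z b \<noteq> Zero" "Z b' \<noteq> Zero" by (auto simp: in_zero_support)
  then have "Z b = neg_sign (U' b)" "U' b \<noteq> Zero" "Z b' = U b'" "U b' \<noteq> Zero"
    using Z(3)[of b] Z(3)[of b'] bz by (auto simp: neg_vector_def)
  moreover have "b \<notin> separator E X U'" "b' \<notin> separator E X U" using U(3) U'(3) by blast+
  then have "X b = U' b" "X b' = U b'"
    using calculation bz by (auto simp: separator_iff)
  ultimately have "Z b = neg_sign (X b)" "Z b' = X b'" by auto
  moreover have "Z = X \<or> Z = neg_vector X" using same_zs[OF S(1) Z(1)] zZ by simp
  ultimately show False
    using bz neg_sign_eq_iff[of "X b" "X b"] neg_sign_eq_iff[of "X b'" "X b'"]
    by (auto simp: neg_vector_def)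
qed

section \<open>Connectedness of cells\<close>

definition region ::
    "'e set \<Rightarrow> 'e set \<Rightarrow> ('e \<Rightarrow> sign) \<Rightarrow> 'e sign_vector set \<Rightarrow> 'e sign_vector set" where
  "region C W \<sigma> N =
    {X \<in> S. (\<forall>e\<in>C. X e = Zero) \<and> (\<forall>e\<in>W. X e = \<sigma> e \<or> X e = Zero)} - N"

text \<open>The parameter \<open>N\<close> serves two purposes: it is the set \<open>F\<close> of
  cocircuits to be avoided, or the complement of an open half-space.\<close>

definition region_connected ::
    "'e set \<Rightarrow> 'e set \<Rightarrow> ('e \<Rightarrow> sign) \<Rightarrow> 'e sign_vector set \<Rightarrow> bool" where
  "region_connected C W \<sigma> N \<longleftrightarrow>
    (\<forall>X\<in>region C W \<sigma> N. \<forall>Y\<in>region C W \<sigma> N. link (region C W \<sigma> N) X Y)"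

text \<open>A path of the larger region that leaves the half-space of \<open>g\<close> does so through the
  hyperplane \<open>g = 0\<close>, and it can be short-cut inside that hyperplane.\<close>

lemma region_connected_insert:
  assumes W: "region_connected C W \<sigma> N" and C: "region_connected (insert g C) W \<sigma> N"
    and g: "\<sigma> g \<noteq> Zero" "g \<in> E"
  shows "region_connected C (insert g W) \<sigma> N"
  unfolding region_connected_def
proof (intro ballI)
  let ?R = "region C W \<sigma> N" and ?R' = "region C (insert g W) \<sigma> N"
  fix X Y assume X: "X \<in> ?R'" and Y: "Y \<in> ?R'"
  have R': "U \<in> ?R' \<longleftrightarrow> U \<in> ?R \<and> (U g = \<sigma> g \<or> U g = Zero)" for U
    by (auto simp: region_def)
  have face: "link ?R' U V" if "U \<in> ?R'" "V \<in> ?R'" "U g = Zero" "V g = Zero" for U V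
  proof -
    have "U \<in> region (insert g C) W \<sigma> N" "V \<in> region (insert g C) W \<sigma> N"
      using that by (auto simp: region_def)
    then have "link (region (insert g C) W \<sigma> N) U V" using C by (simp add: region_connected_def)
    then show ?thesis by (rule link_mono) (auto simp: region_def)
  qed
  have "(X, Y) \<in> (edges \<inter> ?R \<times> ?R)\<^sup>*"
    using W X Y R' by (simp add: region_connected_def link_def)
  \<comment> \<open>Invariant along the path: while the path is on the wrong side of
    \<open>g\<close>, a point \<open>P\<close> of the hyperplane reachable from \<open>X\<close>
    inside the half-space is remembered.\<close>
  then have "(Y \<in> ?R' \<and> link ?R' X Y) \<or>
     (Y g \<noteq> \<sigma> g \<and> Y g \<noteq> Zero \<and> (\<exists>P\<in>?R'. P g = Zero \<and> link ?R' X P))"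
  proof (induction rule: rtrancl_induct)
    case base
    show ?case using X by simp
  next
    case (step U V)
    have UV: "(U, V) \<in> edges" "V \<in> ?R" using step.hyps by auto
    have "g \<notin> separator E U V" using UV by (simp add: edges_iff)
    then have sep: "U g = Zero \<or> V g = Zero \<or> U g = V g" using g by (auto simp: separator_iff)
    show ?case
    proof (cases "V g = \<sigma> g \<or> V g = Zero")
      case True
      then have V: "V \<in> ?R'" using UV R' by simp
      from step.IH show ?thesis
      proof (elim disjE conjE bexE)
        assume "U \<in> ?R'" "link ?R' X U"
        then show ?thesis using V link_edge[OF UV(1)] link_trans by blast
      next
        fix P assume P: "U g \<noteq> \<sigma> g" "U g \<noteq> Zero" "P \<in> ?R'" "P g = Zero" "link ?R' X P"
        then have "V g = Zero" using sep True by auto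
        then show ?thesis using V P face link_trans by blast
      qed
    next
      case False
      from step.IH show ?thesis
      proof (elim disjE conjE bexE)
        assume U: "U \<in> ?R'" "link ?R' X U"
        then have "U g = \<sigma> g \<or> U g = Zero" using R' by blast
        then have "U g = Zero" using sep False by auto
        then have "\<exists>P\<in>?R'. P g = Zero \<and> link ?R' X P" using U by blast
        then show ?thesis using False by simp
      next
        fix P assume "P \<in> ?R'" "P g = Zero" "link ?R' X P"
        then have "\<exists>P\<in>?R'. P g = Zero \<and> link ?R' X P" by blast
        then show ?thesis using False by simp
      qed
    qed
  qed
  then show "link ?R' X Y" using Y R' by auto
qed

text \<open>Without facet constraints, \<open>Y\<close> is brought to \<open>X\<close> by exchanging
  its zeros for zeros of \<open>X\<close> one at a time, always choosing the cocircuit with sign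
  \<open>s\<close> at \<open>g\<close>. Arcs between successive cocircuits keep this sign and the
  common zeros. The constraints in \<open>W\<close> are then added by
  \<open>region_connected_insert\<close>.\<close>

lemma region_connected_open_hemisphere:
  assumes "finite W" "W \<subseteq> E" "\<forall>e\<in>W. \<sigma> e \<noteq> Zero" "g \<in> E" "s \<noteq> Zero"
  shows "region_connected C W \<sigma> {X. X g \<noteq> s}"
  using assms(1-3)
proof (induction W arbitrary: C rule: finite_induct)
  case empty
  have *: "link {U \<in> S. zs X \<inter> zs Y \<subseteq> zs U \<and> U g = s} X Y"
    if "X \<in> S" "Y \<in> S" "X g = s" "Y g = s" for X Y
    using that
  proof (induction "card (zs X - zs Y)" arbitrary: Y)
    case 0
    then have "zs X \<subseteq> zs Y" using finite_zs by simp
    then have "zs Y = zs X" using zs_eqI[of Y "zs X"] 0 card_zs by metis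
    then have "Y = X \<or> Y = neg_vector X" using same_zs[of X Y] 0 by simp
    then have "Y = X" using 0 assms(5) neg_sign_eq_iff[of s s] by (auto simp: neg_vector_def)
    then show ?case by simp
  next
    case (Suc m)
    note X = \<open>X \<in> S\<close> and Y = \<open>Y \<in> S\<close>
    obtain a where a: "a \<in> zs X" "a \<notin> zs Y"
      using Suc.hyps(2) by (metis Diff_iff all_not_in_conv card.empty nat.distinct(1))
    obtain b where b: "b \<in> zs Y" "b \<notin> zs X"
      using Suc.hyps(2) card_Diff_zs_commute[OF X Y]
      by (metis Diff_iff all_not_in_conv card.empty nat.distinct(1))
    let ?I = "insert a (zs Y - {b})"
    have "a \<noteq> g" using a(1) Suc.prems assms(5) by (auto simp: in_zero_support)
    then have "g \<in> E - ?I" using assms(4,5) Suc.prems by (auto simp: in_zero_support)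
    then obtain Z where Z: "Z \<in> S" "zs Z = ?I" "Z g = s"
      by (rule cocircuit_with_sign[rotated 2])
        (use assms(5) a zs_subset card_zs_exchange[OF Y b(1) a(2)] in auto)
    have "zs X - zs Z = (zs X - zs Y) - {a}" using a b Z(2) by auto
    then have "card (zs X - zs Z) = m" using Suc.hyps(2) a finite_zs by simp
    then have "link {U \<in> S. zs X \<inter> zs Z \<subseteq> zs U \<and> U g = s} X Z"
      using Suc.hyps(1)[of Z] X Z Suc.prems by simp
    then have 1: "link {U \<in> S. zs X \<inter> zs Y \<subseteq> zs U \<and> U g = s} X Z"
      by (rule link_mono) (use Z(2) b in auto)
    have "zs Z - zs Y = {a}" using Z(2) a by auto
    then have "link (between Z Y) Z Y" using link_between[OF Z(1) Y] by simp
    moreover have "between Z Y \<subseteq> {U \<in> S. zs X \<inter> zs Y \<subseteq> zs U \<and> U g = s}"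
    proof (intro subsetI CollectI conjI)
      fix U assume U: "U \<in> between Z Y"
      show "U \<in> S" using U by (simp add: between_def)
      show "U g = s" using U Z(3) Suc.prems by (simp add: between_def)
      fix e assume e: "e \<in> zs X \<inter> zs Y"
      then have "e \<in> zs Z" using Z(2) b by auto
      then show "e \<in> zs U" using e U by (auto simp: between_def in_zero_support)
    qed
    ultimately show ?case using 1 by (meson link_mono link_trans)
  qed
  show ?case unfolding region_connected_def
  proof (intro ballI)
    fix X Y
    assume XY: "X \<in> region C {} \<sigma> {X. X g \<noteq> s}" "Y \<in> region C {} \<sigma> {X. X g \<noteq> s}"
    then have "link {U \<in> S. zs X \<inter> zs Y \<subseteq> zs U \<and> U g = s} X Y"
      by (intro *) (auto simp: region_def)
    then show "link (region C {} \<sigma> {X. X g \<noteq> s}) X Y"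
    proof (rule link_mono, intro subsetI)
      fix U assume U: "U \<in> {U \<in> S. zs X \<inter> zs Y \<subseteq> zs U \<and> U g = s}"
      have "U e = Zero" if "e \<in> C" for e
      proof (cases "e \<in> E")
        case True
        then have "e \<in> zs X \<inter> zs Y" using that XY by (auto simp: region_def in_zero_support)
        then have "e \<in> zs U" using U by auto
        then show ?thesis by (simp add: in_zero_support)
      qed (use U zero_outside in auto)
      then show "U \<in> region C {} \<sigma> {X. X g \<noteq> s}" using U by (auto simp: region_def)
    qed
  qed
next
  case (insert h W)
  then show ?case by (intro region_connected_insert) auto
qed

section \<open>Avoiding a small set of cocircuits\<close>

definition vanishing :: "'e sign_vector set \<Rightarrow> 'e set \<Rightarrow> 'e sign_vector set" where
  "vanishing F C = {X \<in> F. \<forall>e\<in>C. X e = Zero}"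

lemma vanishing_insert: "vanishing F (insert g C) = {X \<in> vanishing F C. X g = Zero}"
  by (auto simp: vanishing_def)

lemma finite_vanishing: "finite F \<Longrightarrow> finite (vanishing F C)"
  by (simp add: vanishing_def)

text \<open>Each of the \<open>r - 1 - card C\<close> lines through \<open>Y\<close> carries an arc from \<open>Y\<close> to the hyperplane
  \<open>a = 0\<close>; these arcs meet only in \<open>Y\<close>, so one of them misses \<open>F\<close>.\<close>

lemma link_hyperplane_avoiding:
  assumes F: "finite F" and C: "C \<subseteq> E" "card (vanishing F C) + card C + 1 < r"
    and Y: "Y \<in> region C {} \<sigma> F" and a: "a \<in> E"
  obtains Z where "Z \<in> region C {} \<sigma> F" "Z a = Zero" "link (region C {} \<sigma> F) Y Z"
proof (cases "Y a = Zero")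
  case True
  then show ?thesis using that[of Y] Y by simp
next
  case False
  have YS: "Y \<in> S" "Y \<notin> F" and CY: "C \<subseteq> zs Y" using Y C by (auto simp: region_def in_zero_support)
  have aY: "a \<notin> zs Y" using False by (simp add: in_zero_support)
  have "\<exists>Z. Z \<in> S \<and> zs Z = insert a (zs Y - {b})" if b: "b \<in> zs Y" for b
  proof -
    have "insert a (zs Y - {b}) \<subseteq> E" using a zs_subset[of Y] by auto
    then obtain X where "{Z \<in> S. zs Z = insert a (zs Y - {b})} = {X, neg_vector X}"
      using two_cocircuits card_zs_exchange[OF YS(1) b aY] by metis
    then show ?thesis by blast
  qed
  \<comment> \<open>\<open>T b\<close> is a point of the hyperplane \<open>a = 0\<close> on the line
    obtained by releasing the zero \<open>b\<close> of \<open>Y\<close>.\<close>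
  then obtain T where T: "\<And>b. b \<in> zs Y \<Longrightarrow> T b \<in> S" "\<And>b. b \<in> zs Y \<Longrightarrow> zs (T b) = insert a (zs Y - {b})"
    by metis
  have arc: "link (between Y (T b)) Y (T b)" if "b \<in> zs Y" for b
  proof -
    have "zs Y - zs (T b) = {b}" using T(2)[OF that] that aY by auto
    then show ?thesis using link_between[OF YS(1) T(1)[OF that]] by simp
  qed
  have arcR: "between Y (T b) \<subseteq> {U \<in> S. zs Y - {b} \<subseteq> zs U}" if "b \<in> zs Y" for b
  proof (intro subsetI CollectI conjI)
    fix U e assume U: "U \<in> between Y (T b)"
    then show "U \<in> S" by (simp add: between_def)
    assume "e \<in> zs Y - {b}"
    then have "e \<in> zs Y" "e \<in> zs (T b)" using T(2)[OF that] by auto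
    then show "e \<in> zs U" using U by (auto simp: between_def in_zero_support)
  qed
  have "\<exists>b\<in>zs Y - C. between Y (T b) \<inter> F = {}"
  proof (rule ccontr)
    assume "\<not> ?thesis"
    then have "\<forall>b\<in>zs Y - C. \<exists>U. U \<in> between Y (T b) \<inter> F" by blast
    then obtain f where f: "\<And>b. b \<in> zs Y - C \<Longrightarrow> f b \<in> between Y (T b) \<inter> F" by metis
    \<comment> \<open>A point on two of the arcs has all zeros of \<open>Y\<close>, so it is
      \<open>Y\<close> or its negative. The negative has the wrong sign at \<open>a\<close>, and
      \<open>Y\<close> is not in \<open>F\<close>.\<close>
    have "inj_on f (zs Y - C)"
    proof (rule inj_onI, rule ccontr)
      fix b b' assume b: "b \<in> zs Y - C" "b' \<in> zs Y - C" "f b = f b'" "b \<noteq> b'"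
      have U: "f b \<in> between Y (T b)" "f b \<in> between Y (T b')" "f b \<in> F"
        using f[OF b(1)] f[OF b(2)] b(3) by auto
      then have "zs Y - {b} \<subseteq> zs (f b)" "zs Y - {b'} \<subseteq> zs (f b)" "f b \<in> S" using arcR b by blast+
      then have "zs (f b) = zs Y" using zs_eqI[of "f b" "zs Y"] b(4) card_zs[OF YS(1)] by blast
      then have "f b = Y \<or> f b = neg_vector Y" using same_zs[OF YS(1) \<open>f b \<in> S\<close>] by simp
      moreover have "f b a = Y a \<or> f b a = Zero"
      proof -
        have "a \<in> zs (T b)" using T(2)[of b] b(1) by simp
        then have "T b a = Zero" by (simp add: in_zero_support)
        then show ?thesis using U(1) by (auto simp: between_def)
      qed
      moreover have "neg_vector Y a \<noteq> Y a" "neg_vector Y a \<noteq> Zero"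
        using False neg_sign_eq_iff[of "Y a" "Y a"] by (auto simp: neg_vector_def)
      ultimately show False using U(3) YS(2) by metis
    qed
    moreover have "f ` (zs Y - C) \<subseteq> vanishing F C"
    proof (intro subsetI, elim imageE)
      fix U b assume U: "U = f b" "b \<in> zs Y - C"
      then have "zs Y - {b} \<subseteq> zs U" "U \<in> F" using f arcR by blast+
      then show "U \<in> vanishing F C" using CY U(2) by (auto simp: vanishing_def in_zero_support)
    qed
    ultimately have "card (zs Y - C) \<le> card (vanishing F C)"
      by (rule card_inj_on_le[OF _ _ finite_vanishing[OF F]])
    moreover have "card (zs Y - C) = r - 1 - card C"
      using card_zs[OF YS(1)] CY finite_subset[OF CY finite_zs] by (simp add: card_Diff_subset)
    ultimately show False using C(2) by linarith
  qed
  then obtain b where b: "b \<in> zs Y - C" "between Y (T b) \<inter> F = {}" by blast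
  have sub: "between Y (T b) \<subseteq> region C {} \<sigma> F"
  proof
    fix U assume U: "U \<in> between Y (T b)"
    then have "U \<in> S" "zs Y - {b} \<subseteq> zs U" using arcR[of b] b(1) by blast+
    then show "U \<in> region C {} \<sigma> F" using U b CY by (auto simp: region_def in_zero_support)
  qed
  have "a \<in> zs (T b)" using T(2)[of b] b(1) by simp
  then have Ta: "T b a = Zero" by (simp add: in_zero_support)
  have Tb: "T b \<in> between Y (T b)" using T(1)[of b] b(1) by (simp add: between_def)
  then show ?thesis
    using that[of "T b"] sub link_mono[OF arc sub] Ta b(1) by auto
qed

text \<open>A cocircuit on the flat of \<open>C\<close> has \<open>r - 1 - card C\<close> zeros
  outside \<open>C\<close>, and the bound says that fewer elements of \<open>F\<close> lie on this
  flat. Induction on the dimension: both cocircuits are moved to a hyperplane \<open>a = 0\<close>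
  on which the bound still holds, and are linked there.\<close>

lemma region_connected_avoiding_empty:
  assumes F: "finite F" "F \<subseteq> S" and C: "C \<subseteq> E" "card (vanishing F C) + card C + 1 < r"
  shows "region_connected C {} \<sigma> F"
  using C
proof (induction "r - card C" arbitrary: C rule: less_induct)
  case less
  let ?R = "region C {} \<sigma> F"
  have finC: "finite C" using less.prems(1) fin finite_subset by blast
  show ?case
  proof (cases "vanishing F C = {} \<and> card C + 2 = r")
    \<comment> \<open>The flat is a line free of \<open>F\<close>. Cocircuits with different zero
      supports are joined by an arc of it.\<close>
    case True
    have RS: "X \<in> S" "C \<subseteq> zs X" if "X \<in> ?R" for X
      using that less.prems(1) by (auto simp: region_def in_zero_support)
    have line: "link ?R X Y" if X: "X \<in> ?R" and Y: "Y \<in> ?R" and ne: "zs X \<noteq> zs Y" for X Y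
    proof -
      have "card (zs X - C) = 1"
        using card_zs[OF RS(1)[OF X]] RS(2)[OF X] True finC by (simp add: card_Diff_subset) arith
      moreover have "card (zs X - zs Y) \<le> card (zs X - C)"
        using RS(2)[OF Y] finite_zs by (intro card_mono) auto
      moreover have "card (zs X - zs Y) \<noteq> 0"
        using zs_eqI[OF RS(1)[OF Y], of "zs X"] card_zs[OF RS(1)[OF X]] ne finite_zs by auto
      ultimately have "link (between X Y) X Y"
        using link_between RS(1) X Y by (metis le_antisym less_one not_le)
      moreover have "between X Y \<subseteq> ?R"
      proof
        fix U assume U: "U \<in> between X Y"
        have "U e = Zero" if "e \<in> C" for e
          using U X Y that by (auto simp: between_def region_def)
        then show "U \<in> ?R" using U True by (auto simp: between_def region_def vanishing_def)
      qed
      ultimately show ?thesis by (rule link_mono)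
    qed
    show ?thesis unfolding region_connected_def
    proof (intro ballI)
      fix X Y assume X: "X \<in> ?R" and Y: "Y \<in> ?R"
      show "link ?R X Y"
      proof (cases "zs X = zs Y")
        case eq: True
        \<comment> \<open>With equal zero supports the path makes a detour over a third cocircuit
          \<open>V\<close> of the line, which vanishes at some \<open>b\<close> where
          \<open>X\<close> does not.\<close>
        have "card (zs X) < card E" using card_zs[OF RS(1)[OF X]] r_le by simp
        then have "\<not> E \<subseteq> zs X" using card_mono[OF finite_zs[of X], of E] by linarith
        then obtain b where b: "b \<in> E" "b \<notin> zs X" by blast
        have "card (insert b C) = r - 1"
          using True b RS(2)[OF X] finC by (auto simp: card_insert_if)
        then obtain V where V: "{Z \<in> S. zs Z = insert b C} = {V, neg_vector V}"
          using two_cocircuits[of "insert b C"] b less.prems(1) by auto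
        then have V: "V \<in> S" "zs V = insert b C" by blast+
        then have "V e = Zero" if "e \<in> C" for e using that by (auto simp: in_zero_support set_eq_iff)
        then have "V \<in> ?R" using True V by (auto simp: region_def vanishing_def)
        moreover have "zs V \<noteq> zs X" using V b by auto
        ultimately show ?thesis using line X Y eq link_trans by metis
      qed (use line X Y in blast)
    qed
  next
    case False
    \<comment> \<open>Passing to the hyperplane raises \<open>card C\<close> by one. Either no
      element of \<open>F\<close> is on the flat and there is room to spare, or \<open>a\<close> is
      chosen so that some \<open>f\<close> in \<open>F\<close> on the flat is off the
      hyperplane.\<close>
    obtain a where a: "a \<in> E" "a \<notin> C" "card (vanishing F (insert a C)) + card C + 2 < r"
    proof (cases "vanishing F C = {}")
      case True
      have "card C < card E" using less.prems r_le by linarith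
      then obtain a where "a \<in> E" "a \<notin> C" using finC by (metis card_mono not_le subsetI)
      then show ?thesis using True False less.prems that[of a] by (auto simp: vanishing_insert)
    next
      case ne: False
      then obtain f where f: "f \<in> vanishing F C" by blast
      then have fS: "f \<in> S" using F by (auto simp: vanishing_def)
      have "card (zs f) < card E" using card_zs[OF fS] r_le by simp
      then have "\<not> E \<subseteq> zs f" using card_mono[OF finite_zs[of f], of E] by linarith
      then obtain a where a: "a \<in> E" "a \<notin> zs f" by blast
      then have a: "a \<in> E" "f a \<noteq> Zero" by (auto simp: in_zero_support)
      then have "a \<notin> C" using f by (auto simp: vanishing_def)
      moreover have "vanishing F (insert a C) \<subset> vanishing F C"
        using a f by (auto simp: vanishing_insert)
      then have "card (vanishing F (insert a C)) < card (vanishing F C)"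
        using finite_vanishing[OF F(1)] by (rule psubset_card_mono[rotated])
      ultimately show ?thesis using that[of a] a less.prems by simp
    qed
    have "region_connected (insert a C) {} \<sigma> F"
      using a less.prems finC by (intro less.hyps) auto
    then have IH: "link ?R X Y" if "X \<in> ?R" "Y \<in> ?R" "X a = Zero" "Y a = Zero" for X Y
    proof -
      have "X \<in> region (insert a C) {} \<sigma> F" "Y \<in> region (insert a C) {} \<sigma> F"
        using that by (auto simp: region_def)
      then have "link (region (insert a C) {} \<sigma> F) X Y"
        using \<open>region_connected (insert a C) {} \<sigma> F\<close> by (simp add: region_connected_def)
      then show ?thesis by (rule link_mono) (auto simp: region_def)
    qed
    show ?thesis unfolding region_connected_def
    proof (intro ballI)
      fix X Y assume X: "X \<in> ?R" and Y: "Y \<in> ?R"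
      obtain X' where X': "X' \<in> ?R" "X' a = Zero" "link ?R X X'"
        using link_hyperplane_avoiding[OF F(1) less.prems X a(1)] .
      obtain Y' where Y': "Y' \<in> ?R" "Y' a = Zero" "link ?R Y Y'"
        using link_hyperplane_avoiding[OF F(1) less.prems Y a(1)] .
      show "link ?R X Y" using X' Y' IH[of X' Y'] link_trans link_sym by metis
    qed
  qed
qed

text \<open>Induction on the facet constraints. If the bound survives on the hyperplane
  \<open>g = 0\<close>, then \<open>region_connected_insert\<close> applies. Otherwise passing to
  the hyperplane loses no element of \<open>F\<close>, and the open half-space is used
  instead.\<close>

lemma region_connected_avoiding:
  assumes F: "finite F" "F \<subseteq> S" and W: "finite W" "W \<subseteq> E" "\<forall>e\<in>W. \<sigma> e \<noteq> Zero"
    and C: "C \<subseteq> E" "card (vanishing F C) + card C + 1 < r"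
  shows "region_connected C W \<sigma> F"
  using W C
proof (induction W arbitrary: C rule: finite_induct)
  case empty
  show ?case using region_connected_avoiding_empty F empty by blast
next
  case (insert g W)
  have finC: "finite C" using insert.prems fin finite_subset by blast
  have g: "g \<in> E" "\<sigma> g \<noteq> Zero" using insert.prems by auto
  have W: "region_connected C W \<sigma> F" using insert by simp
  have le: "card (vanishing F (insert g C)) \<le> card (vanishing F C)"
    by (intro card_mono finite_vanishing F) (auto simp: vanishing_insert)
  show ?case
  proof (cases "g \<in> C \<or> card (vanishing F (insert g C)) + card C + 2 < r")
    case True
    have "region_connected (insert g C) W \<sigma> F"
    proof (cases "g \<in> C")
      case True
      then show ?thesis using W by (simp add: insert_absorb)
    next
      case False
      then show ?thesis using True insert.prems finC by (intro insert.IH) auto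
    qed
    then show ?thesis using region_connected_insert W g by blast
  next
    case False
    then have "card (vanishing F (insert g C)) = card (vanishing F C)"
      using le insert.prems by linarith
    then have "vanishing F (insert g C) = vanishing F C"
      by (intro card_subset_eq finite_vanishing F) (auto simp: vanishing_insert)
    then have Fg: "U g = Zero" if "U \<in> F" "\<forall>e\<in>C. U e = Zero" for U
      using that by (auto simp: vanishing_def)
    \<comment> \<open>All of \<open>F\<close> lies on \<open>g = 0\<close>, so it suffices to step off this hyperplane and stay off it.\<close>
    let ?R = "region C (insert g W) \<sigma> F" and ?H = "region C W \<sigma> {X. X g \<noteq> \<sigma> g}"
    have HR: "?H \<subseteq> ?R"
    proof
      fix U assume U: "U \<in> ?H"
      then have "U \<notin> F" using Fg[of U] g(2) by (auto simp: region_def)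
      then show "U \<in> ?R" using U by (auto simp: region_def)
    qed
    have H: "link ?R X Y" if "X \<in> ?H" "Y \<in> ?H" for X Y
      using region_connected_open_hemisphere[of W \<sigma> g "\<sigma> g" C] that insert g link_mono[OF _ HR]
      by (simp add: region_connected_def)
    have toH: "\<exists>X'\<in>?H. link ?R X X'" if X: "X \<in> ?R" for X
    proof (cases "X g = Zero")
      case True
      have XS: "X \<in> S" using X by (simp add: region_def)
      \<comment> \<open>This neighbour gives up no zero of \<open>X\<close> except \<open>g\<close>
        and contradicts none of its signs, so it remains in the cell.\<close>
      obtain U where U: "(X, U) \<in> edges" "U g = \<sigma> g"
        using neighbour_with_sign[OF XS _ g(2)] True g(1) by (auto simp: in_zero_support)
      have "g \<in> zs X - zs U" using True g U by (auto simp: in_zero_support)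
      moreover have "card (zs X - zs U) = 1" using U(1) by (simp add: edges_iff)
      ultimately have zg: "zs X - zs U = {g}" by (metis card_1_singletonE singletonD)
      have Ue: "U e = X e \<or> U e = Zero" if "e \<noteq> g" for e
      proof (cases "e \<in> E \<and> X e \<noteq> Zero")
        case True
        have "e \<notin> separator E X U" using U(1) by (simp add: edges_iff)
        then show ?thesis using True by (auto simp: separator_iff)
      next
        case False
        then have "e \<notin> E \<or> e \<in> zs X" by (auto simp: in_zero_support)
        then have "e \<notin> E \<or> e \<in> zs U" using zg that by blast
        moreover have "U \<in> S" using U(1) by (simp add: edges_iff)
        ultimately have "U e = Zero" using zero_outside by (auto simp: in_zero_support)
        then show ?thesis by simp
      qed
      have "U e = Zero" if "e \<in> C" for e
        using Ue[of e] that X \<open>\<not> (g \<in> C \<or> _)\<close> by (auto simp: region_def)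
      moreover have "U e = \<sigma> e \<or> U e = Zero" if "e \<in> W" for e
      proof -
        have "e \<noteq> g" "X e = \<sigma> e \<or> X e = Zero" using that X insert.hyps by (auto simp: region_def)
        then show ?thesis using Ue[of e] by auto
      qed
      ultimately have "U \<in> ?H" using U by (auto simp: region_def edges_iff)
      then show ?thesis using link_edge[OF U(1) X] HR by blast
    next
      case False
      then show ?thesis using X by (intro bexI[of _ X]) (auto simp: region_def)
    qed
    show ?thesis unfolding region_connected_def
    proof (intro ballI)
      fix X Y assume "X \<in> ?R" "Y \<in> ?R"
      then obtain X' Y' where "X' \<in> ?H" "link ?R X X'" "Y' \<in> ?H" "link ?R Y Y'" using toH by metis
      then show "link ?R X Y" using H[of X' Y'] link_trans link_sym by metis
    qed
  qed
qed

text \<open>The admissible signs cut out a cell: \<open>C\<close> consists of the common zeros, and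
  on \<open>W\<close> the vector \<sigma> takes the non-zero sign that \<open>X\<close> or
  \<open>Y\<close> has. Elements of the separator impose no condition, since both signs occur there.
  As \<open>card C + card (zs X - zs Y) = r - 1\<close>, the bound on \<open>F\<close> is the one
  required.\<close>

lemma link_avoiding:
  assumes XY: "X \<in> S" "Y \<in> S" and F: "finite F" "F \<subseteq> S" "X \<notin> F" "Y \<notin> F"
    and card: "card F < card (zs X - zs Y)"
  shows "link ({U \<in> S. \<forall>e. U e \<in> {X e, Y e, Zero}} - F) X Y"
proof -
  define C W where "C = zs X \<inter> zs Y" and "W = {e \<in> E. e \<notin> C \<and> e \<notin> separator E X Y}"
  define \<sigma> where "\<sigma> e = (if X e = Zero then Y e else X e)" for e
  have "card (vanishing F C) \<le> card F" by (intro card_mono F) (auto simp: vanishing_def)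
  then have "region_connected C W \<sigma> F"
    using fin card card_Diff_zs[OF XY] zs_subset
    by (intro region_connected_avoiding F)
      (auto simp: W_def C_def \<sigma>_def in_zero_support)
  moreover have "X \<in> region C W \<sigma> F" "Y \<in> region C W \<sigma> F"
    using XY F by (auto simp: region_def C_def W_def \<sigma>_def in_zero_support separator_iff)
  ultimately have "link (region C W \<sigma> F) X Y" by (simp add: region_connected_def)
  then show ?thesis
  proof (rule link_mono, intro subsetI)
    fix U assume U: "U \<in> region C W \<sigma> F"
    have "U e \<in> {X e, Y e, Zero}" for e
    proof -
      consider "e \<notin> E" | "e \<in> C" | "e \<in> separator E X Y" | "e \<in> W" by (auto simp: W_def)
      then show ?thesis
      proof cases
        case 3
        then show ?thesis
          by (cases "X e"; cases "Y e"; cases "U e") (auto simp: separator_iff)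
      next
        case 4
        then have "U e = \<sigma> e \<or> U e = Zero" using U by (simp add: region_def)
        then show ?thesis by (auto simp: \<sigma>_def)
      qed (use U zero_outside in \<open>auto simp: region_def\<close>)
    qed
    then show "U \<in> {U \<in> S. \<forall>e. U e \<in> {X e, Y e, Zero}} - F" using U by (auto simp: region_def)
  qed
qed

end

section \<open>Crabbed paths\<close>

lemma set_walk_subset: "walk A p \<Longrightarrow> set p \<subseteq> insert (hd p) (snd ` A)"
proof (induction p)
  case (Cons x p)
  then show ?case by (force simp: walk_Cons)
qed simp

lemma vwalk_with_proj_iff: "vwalk p (with_proj G) \<longleftrightarrow> set p \<subseteq> pverts G \<and> walk (parcs G) p"
proof -
  have "set (vwalk_arcs p) \<subseteq> A \<longleftrightarrow> successively (\<lambda>x y. (x, y) \<in> A) p" for A :: "('a \<times> 'a) set"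
    by (induction p rule: vwalk_arcs.induct) auto
  moreover have "arcs_ends (with_proj G) = parcs G"
    by (auto simp: arcs_ends_def arc_to_ends_def)
  ultimately show ?thesis by (auto simp: vwalk_def walk_def)
qed

text \<open>Read element by element, being crabbed is the sign condition of C3.\<close>

lemma crabbed_iff:
  "crabbed E L v w p \<longleftrightarrow> (\<forall>u\<in>set p. \<forall>e\<in>E. L u e \<in> {L v e, L w e, Zero})"
proof -
  have "pos_part E X \<subseteq> pos_part E Y \<union> pos_part E Z \<and> neg_part E X \<subseteq> neg_part E Y \<union> neg_part E Z
    \<longleftrightarrow> (\<forall>e\<in>E. X e \<in> {Y e, Z e, Zero})" for X Y Z
  proof -
    have "X e \<in> {Y e, Z e, Zero} \<longleftrightarrow>
      (X e = Pos \<longrightarrow> Y e = Pos \<or> Z e = Pos) \<and> (X e = Neg \<longrightarrow> Y e = Neg \<or> Z e = Neg)" for e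
      by (cases "X e") auto
    then show ?thesis unfolding pos_part_def neg_part_def by blast
  qed
  then show ?thesis by (simp add: crabbed_def)
qed

lemma crabbed_paths_iff:
  "p \<in> crabbed_paths E G L v w \<longleftrightarrow>
    walk (parcs G) p \<and> distinct p \<and> set p \<subseteq> pverts G \<and> hd p = v \<and> last p = w \<and>
    (\<forall>u\<in>set p. \<forall>e\<in>E. L u e \<in> {L v e, L w e, Zero})"
  by (auto simp: crabbed_paths_def vpath_def vwalk_with_proj_iff crabbed_iff)

text \<open>A discrete intermediate value argument: a sign cannot flip along an arc without passing
  through zero.\<close>

lemma walk_sign_constant:
  assumes "walk A p" "\<And>u v. (u, v) \<in> A \<Longrightarrow> f u = Zero \<or> f v = Zero \<or> f u = f v"
    and "\<forall>u\<in>set p. f u \<noteq> Zero"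
  shows "f (last p) = f (hd p)"
  using assms(1,3)
proof (induction p)
  case (Cons x p)
  show ?case
  proof (cases "p = []")
    case False
    then have "(x, hd p) \<in> A" "f (last p) = f (hd p)" "f (hd p) \<noteq> Zero"
      using Cons by (auto simp: walk_Cons)
    moreover have "f x \<noteq> Zero" using Cons.prems by simp
    ultimately show ?thesis using False assms(2)[of x "hd p"] by auto
  qed simp
qed (simp add: walk_def)

text \<open>The eliminating vector is the label of a vertex on a crabbed path where the sign at
  \<open>e\<close> vanishes.\<close>

lemma axiom_C3_if_crabbed_paths:
  assumes L: "sign_labeling E r G L" and G: "pair_graph G"
    and paths: "\<And>v w. v \<in> pverts G \<Longrightarrow> w \<in> pverts G \<Longrightarrow>
      zero_support E (L v) \<noteq> zero_support E (L w) \<Longrightarrow> \<exists>p. p \<in> crabbed_paths E G L v w"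
    and card: "1 \<le> r" "r \<le> card E" "finite E"
  shows "axiom_C3 E (L ` pverts G)"
  unfolding axiom_C3_def
proof (intro ballI impI, elim imageE)
  interpret pair_graph G by (rule G)
  fix X Y e v w
  assume XY: "X \<noteq> neg_vector Y" "e \<in> separator E X Y"
    and v: "X = L v" "v \<in> pverts G" and w: "Y = L w" "w \<in> pverts G"
  have e: "e \<in> E" "X e \<noteq> Zero" "Y e \<noteq> Zero" "X e \<noteq> Y e" using XY(2) by (auto simp: separator_iff)
  \<comment> \<open>Otherwise C2 leaves only \<open>X = Y\<close>, excluded by \<open>e\<close>, and
    \<open>X = neg_vector Y\<close>, excluded by assumption.\<close>
  have "zero_support E X \<noteq> zero_support E Y"
  proof
    assume eq: "zero_support E X = zero_support E Y"
    let ?I = "support E X"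
    have "card ?I = card E - r + 1" "?I \<subseteq> E"
      using L v by (auto simp: sign_labeling_def axiom_C1_def support_def)
    then have "\<exists>U V. U \<noteq> V \<and> {Z \<in> L ` pverts G. support E Z = ?I} = {U, V} \<and> V = neg_vector U"
      using L unfolding sign_labeling_def axiom_C2_def by blast
    then obtain U where U: "{Z \<in> L ` pverts G. support E Z = ?I} = {U, neg_vector U}"
      by blast
    have "support E Y = ?I" using eq by (simp add: support_def)
    then have "X \<in> {U, neg_vector U}" "Y \<in> {U, neg_vector U}" using U v w by blast+
    then have "X = Y \<or> X = neg_vector Y" by auto
    then show False using XY e by auto
  qed
  then obtain p where "p \<in> crabbed_paths E G L v w" using paths v w by blast
  then have p: "walk (parcs G) p" "set p \<subseteq> pverts G" "hd p = v" "last p = w"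
    "\<forall>u\<in>set p. \<forall>f\<in>E. L u f \<in> {X f, Y f, Zero}"
    unfolding crabbed_paths_iff v w by blast+
  have step: "L u e = Zero \<or> L u' e = Zero \<or> L u e = L u' e" if "(u, u') \<in> parcs G" for u u'
  proof -
    have "u \<in> pverts G" "u' \<in> pverts G" using that in_arcsD1 in_arcsD2 by blast+
    then have "separator E (L u) (L u') = {}" using L that by (auto simp: sign_labeling_def)
    then show ?thesis using e(1) by (auto simp: separator_iff)
  qed
  have "\<exists>u\<in>set p. L u e = Zero"
  proof (rule ccontr)
    assume "\<not> ?thesis"
    then have "L (last p) e = L (hd p) e"
      using walk_sign_constant[of "parcs G" p "\<lambda>u. L u e"] p(1) step by blast
    then show False using p(3,4) e v w by simp
  qed
  then obtain u where u: "u \<in> set p" "L u e = Zero" by blast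
  then have "L u \<in> L ` pverts G" "\<forall>f\<in>E - {e}. L u f \<in> {X f, Y f, Zero}"
    using p by blast+
  then show "\<exists>Z\<in>L ` pverts G. Z e = Zero \<and> (\<forall>f\<in>E - {e}. Z f \<in> {X f, Y f, Zero})"
    using u(2) by blast
qed

section \<open>Disjoint crabbed paths in the graph of an oriented matroid\<close>

locale om_graph = pair_graph G + uniform_om E r "L ` pverts G"
  for G :: "'v pair_pre_digraph" and E :: "'e set" and r :: nat and L :: "'v \<Rightarrow> 'e sign_vector" +
  assumes labeling: "sign_labeling E r G L"
begin

lemma inj_L: "inj_on L (pverts G)"
  using labeling by (simp add: sign_labeling_def)

lemma arcs_iff: "(v, w) \<in> parcs G \<longleftrightarrow> v \<in> pverts G \<and> w \<in> pverts G \<and> (L v, L w) \<in> edges"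
proof (cases "v \<in> pverts G \<and> w \<in> pverts G")
  case True
  then show ?thesis using labeling by (auto simp: sign_labeling_def edges_def)
next
  case False
  then show ?thesis using in_arcsD1 in_arcsD2 by blast
qed

text \<open>Each path is sent to the zero of \<open>L v\<close> that its first step gives up. There
  the second vertex has the sign of \<open>L w\<close>, so \<open>neighbour_unique\<close> recovers
  this vertex, and disjointness makes the map injective.\<close>

lemma card_disjoint_crabbed_paths_le:
  assumes vw: "v \<in> pverts G" "w \<in> pverts G" "v \<noteq> w"
    and P: "P \<subseteq> crabbed_paths E G L v w" "vertex_disjoint v w P"
  shows "finite P \<and> card P \<le> card (zs (L v) - zs (L w))"
proof -
  have ex: "\<exists>a u q. p = v # u # q \<and> (v, u) \<in> parcs G \<and> a \<in> zs (L v) - zs (L w) \<and> L u a = L w a"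
    if "p \<in> P" for p
  proof -
    have p: "walk (parcs G) p" "hd p = v" "last p = w"
      "\<forall>u\<in>set p. \<forall>e\<in>E. L u e \<in> {L v e, L w e, Zero}"
      using subsetD[OF P(1) that] unfolding crabbed_paths_iff by blast+
    obtain u q where q: "p = v # u # q"
      using p(1-3) vw(3) by (cases p rule: remdups_adj.cases) (auto simp: walk_def)
    have uv: "(v, u) \<in> parcs G" using p(1) q by (auto simp: walk_Cons)
    then have "card (zs (L v) - zs (L u)) = 1" by (simp add: arcs_iff edges_iff)
    then obtain a where "zs (L v) - zs (L u) = {a}" by (auto simp: card_1_singleton_iff)
    then have "a \<in> zs (L v) - zs (L u)" by simp
    then have a: "a \<in> zs (L v)" "L u a \<noteq> Zero" "a \<in> E" by (auto simp: in_zero_support)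
    then have "L u a = L w a" using p(4) q by (auto simp: in_zero_support)
    then show ?thesis using a q uv by (auto simp: in_zero_support)
  qed
  then obtain f where f: "\<And>p. p \<in> P \<Longrightarrow> \<exists>u q. p = v # u # q \<and> (v, u) \<in> parcs G \<and>
      f p \<in> zs (L v) - zs (L w) \<and> L u (f p) = L w (f p)"
    by metis
  have "inj_on f P"
  proof (rule inj_onI, rule ccontr)
    fix p p' assume p: "p \<in> P" "p' \<in> P" "f p = f p'" "p \<noteq> p'"
    obtain u q where q: "p = v # u # q" "(v, u) \<in> parcs G"
      "f p \<in> zs (L v) - zs (L w)" "L u (f p) = L w (f p)" using f[OF p(1)] by blast
    obtain u' q' where q': "p' = v # u' # q'" "(v, u') \<in> parcs G"
      "L u' (f p) = L w (f p)" using f[OF p(2)] p(3) by auto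
    have "L v (f p) = Zero" "L w (f p) \<noteq> Zero" using q(3) by (auto simp: in_zero_support)
    then have "L u = L u'"
      using neighbour_unique[of "L v" "L u" "L u'" "f p"] q q' by (simp add: arcs_iff)
    then have uu': "u = u'" using inj_L q(2) q'(2) by (auto simp: arcs_iff inj_on_def)
    have "set p \<inter> set p' \<subseteq> {v, w}" using P(2) p by (auto simp: vertex_disjoint_def)
    moreover have d: "distinct p" "distinct p'" "last p = w" "last p' = w"
      using p P(1) by (auto simp: crabbed_paths_iff)
    \<comment> \<open>A shared second vertex is an end of both paths, and it is not
      \<open>v\<close>. Reaching \<open>w\<close> at once, both paths are the single edge.\<close>
    ultimately have "u = w" using q(1) q'(1) uu' by auto
    then have "q = []" "q' = []"
      using d q(1) q'(1) uu' last_in_set[of q] last_in_set[of q'] by (auto split: if_splits)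
    then show False using p(4) q(1) q'(1) uu' by simp
  qed
  moreover have "f ` P \<subseteq> zs (L v) - zs (L w)" using f by blast
  moreover have "finite (zs (L v) - zs (L w))" using finite_zs by simp
  ultimately show ?thesis by (metis inj_on_finite card_inj_on_le)
qed

text \<open>The path of cocircuits from \<open>link_avoiding\<close> is pulled back along the
  injective labeling.\<close>

lemma path_avoiding:
  assumes vw: "v \<in> pverts G" "w \<in> pverts G" and D: "D \<subseteq> pverts G - {v, w}"
    and card: "card D < card (zs (L v) - zs (L w))"
  obtains p where "walk (parcs G) p" "distinct p" "hd p = v" "last p = w"
    "set p \<subseteq> pverts G - D" "\<And>u e. u \<in> set p \<Longrightarrow> L u e \<in> {L v e, L w e, Zero}"
proof -
  define K where "K = {u \<in> pverts G - D. \<forall>e. L u e \<in> {L v e, L w e, Zero}}"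
  define F where "F = L ` D"
  have finD: "finite D" using D pair_finite_verts finite_subset by blast
  have "L v \<notin> F" "L w \<notin> F" using D vw inj_L by (auto simp: F_def inj_on_def)
  moreover have "card F < card (zs (L v) - zs (L w))"
    using card card_image_le[OF finD, of L] by (simp add: F_def)
  ultimately have "link ({U \<in> L ` pverts G. \<forall>e. U e \<in> {L v e, L w e, Zero}} - F) (L v) (L w)"
    using vw D finD by (intro link_avoiding) (auto simp: F_def)
  moreover have "{U \<in> L ` pverts G. \<forall>e. U e \<in> {L v e, L w e, Zero}} - F \<subseteq> L ` K"
    by (auto simp: K_def F_def)
  ultimately have "(L v, L w) \<in> (edges \<inter> L ` K \<times> L ` K)\<^sup>*"
    using link_mono unfolding link_def by blast
  then have "\<exists>u\<in>pverts G. L u = L w \<and> (v, u) \<in> (parcs G \<inter> K \<times> K)\<^sup>*"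
  proof (induction rule: rtrancl_induct)
    case base
    then show ?case using vw by blast
  next
    case (step U V)
    then obtain u where u: "u \<in> pverts G" "L u = U" "(v, u) \<in> (parcs G \<inter> K \<times> K)\<^sup>*" by blast
    obtain x y where xy: "x \<in> K" "y \<in> K" "U = L x" "V = L y" "(L x, L y) \<in> edges" using step.hyps by auto
    then have "x \<in> pverts G" "y \<in> pverts G" by (auto simp: K_def)
    moreover from this have "u = x" using u xy inj_L by (auto simp: inj_on_def)
    ultimately have "(u, y) \<in> parcs G \<inter> K \<times> K" using xy by (auto simp: arcs_iff)
    then show ?case using u xy \<open>y \<in> pverts G\<close> rtrancl_into_rtrancl by metis
  qed
  then have "(v, w) \<in> (parcs G \<inter> K \<times> K)\<^sup>*" using vw inj_L by (auto simp: inj_on_def)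
  then obtain p where p: "walk (parcs G \<inter> K \<times> K) p" "distinct p" "hd p = v" "last p = w"
    by (rule rtrancl_distinct_walk)
  have "v \<in> K" using vw D by (auto simp: K_def)
  then have "set p \<subseteq> K" using set_walk_subset[OF p(1)] p(3) by auto
  then show ?thesis using that[of p] p walk_mono[OF p(1), of "parcs G"] by (auto simp: K_def)
qed

text \<open>Menger's theorem is applied to the possible interior vertices \<open>K\<close>, with the
  neighbours of \<open>v\<close> and of \<open>w\<close> as the two terminal sets. This needs
  \<open>v\<close> and \<open>w\<close> to be non-adjacent, which holds for
  \<open>k \<ge> 2\<close>; for \<open>k = 1\<close> a single path suffices.\<close>

lemma ex_disjoint_crabbed_paths:
  assumes vw: "v \<in> pverts G" "w \<in> pverts G" "v \<noteq> w"
  shows "\<exists>P\<subseteq>crabbed_paths E G L v w.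
    vertex_disjoint v w P \<and> finite P \<and> card P = card (zs (L v) - zs (L w))"
proof -
  define k where "k = card (zs (L v) - zs (L w))"
  consider "k = 0" | "k = 1" | "k \<ge> 2" by linarith
  then show ?thesis
  proof cases
    case 1
    then show ?thesis by (intro exI[of _ "{}"]) (auto simp: k_def vertex_disjoint_def)
  next
    case 2
    then obtain p where "walk (parcs G) p" "distinct p" "hd p = v" "last p = w"
      "set p \<subseteq> pverts G - {}" "\<And>u e. u \<in> set p \<Longrightarrow> L u e \<in> {L v e, L w e, Zero}"
      using path_avoiding[of v w "{}"] vw by (auto simp: k_def)
    then have "p \<in> crabbed_paths E G L v w" by (simp add: crabbed_paths_iff)
    then show ?thesis using 2 by (intro exI[of _ "{p}"]) (auto simp: k_def vertex_disjoint_def)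
  next
    case 3
    define K where "K = {u \<in> pverts G - {v, w}. \<forall>e. L u e \<in> {L v e, L w e, Zero}}"
    define A where "A = parcs G \<inter> K \<times> K"
    define P where "P = {x \<in> K. (v, x) \<in> parcs G}"
    define Q where "Q = {y \<in> K. (y, w) \<in> parcs G}"
    have nadj: "(v, w) \<notin> parcs G" using 3 by (auto simp: arcs_iff edges_iff k_def)
    \<comment> \<open>If \<open>D\<close> were smaller, some crabbed path would avoid
      \<open>D \<inter> K\<close>. Its interior \<open>m\<close> is non-empty and runs inside
      \<open>K\<close> from \<open>P\<close> to \<open>Q\<close>, contradicting separation.\<close>
    have "k \<le> card D" if "finite D" "separates A P Q D" for D
    proof (rule ccontr)
      assume "\<not> k \<le> card D"
      moreover have "card (D \<inter> K) \<le> card D" using that(1) by (intro card_mono) auto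
      ultimately have lt: "card (D \<inter> K) < card (zs (L v) - zs (L w))" by (simp add: k_def)
      have "D \<inter> K \<subseteq> pverts G - {v, w}" by (auto simp: K_def)
      from path_avoiding[OF vw(1,2) this lt] obtain p
        where p: "walk (parcs G) p" "distinct p" "hd p = v" "last p = w"
        "set p \<subseteq> pverts G - D \<inter> K" "\<And>u e. u \<in> set p \<Longrightarrow> L u e \<in> {L v e, L w e, Zero}"
        by metis
      obtain q where q: "p = v # q" using p(1,3) by (cases p) (auto simp: walk_def)
      then have "q \<noteq> []" using p(4) vw(3) by auto
      then have "q = butlast q @ [w]" using p(4) q by (metis append_butlast_last_id last_ConsR)
      then obtain m where m: "p = v # m @ [w]" using q by metis
      have mne: "m \<noteq> []" using p(1) nadj m by (auto simp: walk_Cons)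
      have mK: "set m \<subseteq> K" using p(2,5,6) m by (auto simp: K_def)
      have wm: "walk (parcs G) m" "(v, hd m) \<in> parcs G" "(last m, w) \<in> parcs G"
        using p(1) mne unfolding m by (auto simp: walk_Cons walk_append)
      have "walk A m"
        using wm(1) mK unfolding walk_def A_def by (auto elim!: successively_mono)
      moreover have "hd m \<in> P" "last m \<in> Q"
        using wm mK mne unfolding P_def Q_def by (auto simp: subset_iff)
      ultimately have "set m \<inter> D \<noteq> {}" using that(2) by (auto simp: separates_def)
      then show False using mK p(5) m by auto
    qed
    moreover have "finite A" "finite P"
      using pair_finite_arcs pair_finite_verts by (auto simp: A_def P_def K_def)
    moreover have "irrefl A"
      using pair_no_loops unfolding irrefl_def A_def by fastforce
    ultimately obtain I f where f: "card I = k" "finite I" "disjoint_paths A P Q I f"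
      using menger[of A P Q k] by metis
    define g where "g i = v # f i @ [w]" for i
    have fi: "walk A (f i)" "distinct (f i)" "hd (f i) \<in> P" "last (f i) \<in> Q" "f i \<noteq> []"
      if "i \<in> I" for i using f(3) that by (auto simp: disjoint_paths_def walk_def)
    have fK: "set (f i) \<subseteq> K" if "i \<in> I" for i
      using set_walk_subset[OF fi(1)[OF that]] fi(3)[OF that] by (auto simp: A_def P_def)
    have dis: "set (f i) \<inter> set (f j) = {}" if "i \<in> I" "j \<in> I" "i \<noteq> j" for i j
      using f(3) that by (auto simp: disjoint_paths_def)
    have gP: "g i \<in> crabbed_paths E G L v w" if "i \<in> I" for i
    proof -
      have "walk (parcs G) (f i)" using fi(1)[OF that] by (rule walk_mono) (auto simp: A_def)
      then have "walk (parcs G) (g i)"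
        using fi[OF that] by (auto simp: g_def walk_Cons walk_append P_def Q_def)
      moreover have "distinct (g i)" using fi(2) fK that vw(3) by (auto simp: g_def K_def)
      ultimately show ?thesis using fK[OF that] vw by (auto simp: crabbed_paths_iff g_def K_def)
    qed
    have "inj_on g I"
    proof (rule inj_onI, rule ccontr)
      fix i j assume ij: "i \<in> I" "j \<in> I" "g i = g j" "i \<noteq> j"
      then have "f i = f j" by (simp add: g_def)
      then show False using dis[OF ij(1,2,4)] fi(5)[OF ij(1)] by simp
    qed
    then have "card (g ` I) = k" using f(1) by (simp add: card_image)
    moreover have "vertex_disjoint v w (g ` I)"
      unfolding vertex_disjoint_def
    proof (intro ballI impI, elim imageE)
      fix p q i j assume "p \<noteq> q" "p = g i" "i \<in> I" "q = g j" "j \<in> I"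
      then show "set p \<inter> set q \<subseteq> {v, w}" using dis[of i j] by (auto simp: g_def)
    qed
    ultimately show ?thesis using gP f(2) by (intro exI[of _ "g ` I"]) (auto simp: k_def)
  qed
qed

end

theorem theorem2p3:
  fixes E :: "'e set" and r :: nat
    and G :: "'v pair_pre_digraph" and L :: "'v \<Rightarrow> 'e sign_vector"
  assumes "finite E" and "1 \<le> r" and "r \<le> card E"
    and "pair_graph G"
    and "sign_labeling E r G L"
  shows "(OM_labeling E r G L \<longleftrightarrow>
          (\<forall>v\<in>pverts G. \<forall>w\<in>pverts G. v \<noteq> w \<longrightarrow>
            max_disjoint_crabbed_paths E G L v w
              (card (zero_support E (L v) - zero_support E (L w)))))
    \<and> (OM_labeling E r G L \<longleftrightarrow>
          (\<forall>v\<in>pverts G. \<forall>w\<in>pverts G. zero_support E (L v) \<noteq> zero_support E (L w) \<longrightarrow>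
            (\<exists>p. p \<in> crabbed_paths E G L v w)))"
    (is "(?OM \<longleftrightarrow> ?disjoint) \<and> (?OM \<longleftrightarrow> ?path)")
proof -
  have "?disjoint" if ?OM
  proof -
    interpret pair_graph G by (rule assms)
    interpret om_graph G E r L
      using that assms(5) by unfold_locales (simp_all add: OM_labeling_def)
    show ?thesis
      unfolding max_disjoint_crabbed_paths_def
      using ex_disjoint_crabbed_paths card_disjoint_crabbed_paths_le by blast
  qed
  \<comment> \<open>Different zero supports of the same size \<open>r - 1\<close> have a non-empty
    difference, so the maximal family contains at least one path.\<close>
  moreover have "?path" if ?disjoint
  proof (intro ballI impI)
    fix v w assume vw: "v \<in> pverts G" "w \<in> pverts G" "zero_support E (L v) \<noteq> zero_support E (L w)"
    have fin: "finite (zero_support E (L u))" for u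
      using assms(1) by (simp add: zero_support_def)
    have "card (zero_support E (L u)) = r - 1" if "u \<in> pverts G" for u
    proof -
      have "card (E - zero_support E (L u)) = card E - r + 1"
        using assms(5) that by (auto simp: sign_labeling_def axiom_C1_def support_def)
      moreover have "card (E - zero_support E (L u)) = card E - card (zero_support E (L u))"
        using fin by (intro card_Diff_subset) (auto simp: zero_support_def)
      ultimately show ?thesis using assms(2,3) by linarith
    qed
    then have "card (zero_support E (L v)) = card (zero_support E (L w))" using vw by simp
    then have "\<not> zero_support E (L v) \<subseteq> zero_support E (L w)"
      using vw(3) card_subset_eq[OF fin] by blast
    then have "card (zero_support E (L v) - zero_support E (L w)) \<noteq> 0" using fin by simp
    moreover have "v \<noteq> w" using vw(3) by blast
    then have "\<exists>P\<subseteq>crabbed_paths E G L v w. card P = card (zero_support E (L v) - zero_support E (L w))"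
      using that vw unfolding max_disjoint_crabbed_paths_def by blast
    then obtain P where "P \<subseteq> crabbed_paths E G L v w"
      "card P = card (zero_support E (L v) - zero_support E (L w))" by blast
    ultimately have "P \<noteq> {}" by auto
    then show "\<exists>p. p \<in> crabbed_paths E G L v w" using \<open>P \<subseteq> _\<close> by blast
  qed
  moreover have ?OM if ?path
    using axiom_C3_if_crabbed_paths[OF assms(5,4) _ assms(2,3,1)] that assms
    by (auto simp: OM_labeling_def uniform_oriented_matroid_def sign_labeling_def)
  ultimately show ?thesis by blast
qed

end
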